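(* For all integers $k>0$ and $\ell>0$, the problems Hamiltonian-$\ell$-Linkedness and $\ell$-Path-Cover can be solved in polynomial time on input graphs of independence number smaller than $k$.
   Context: Graphs are finite, simple and undirected. A graph $G$ is Hamiltonian-$\ell$-linked if it has at least $2\ell$ vertices and for every sequence of distinct vertices $s_1,\dots,s_\ell,t_1,\dots,t_\ell$ there exist pairwise vertex-disjoint paths $P_1,\dots,P_\ell$ such that $P_i$ has end-vertices $s_i$ and $t_i$ and $\bigcup_i V(P_i)=V(G)$. Hamiltonian-$\ell$-Linkedness: given $G$, decide whether $G$ is Hamiltonian-$\ell$-linked. $\ell$-Path-Cover: given $G$, decide whether there exist distinct vertices $s_1,\dots,s_\ell,t_1,\dots,t_\ell$ and pairwise vertex-disjoint paths $P_1,\dots,P_\ell$ with $P_i$ having end-vertices $s_i,t_i$ and $\bigcup_i V(P_i)=V(G)$. *)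

theory Defs
  imports
    "Graph_Theory.Pair_Digraph"
    "Graph_Theory.Vertex_Walk"
    "HOL-Computational_Algebra.Polynomial"
begin

section \<open>Graphs\<close>

text \<open>
  Finite simple undirected graphs are the loop-free symmetric digraphs of the locale
  \<^locale>\<open>pair_graph\<close>; an undirected edge is the pair of its two opposite arcs.
\<close>

definition independent_set :: "'a pair_pre_digraph \<Rightarrow> 'a set \<Rightarrow> bool" where
  "independent_set G S \<longleftrightarrow> S \<subseteq> pverts G \<and> (\<forall>u\<in>S. \<forall>v\<in>S. (u, v) \<notin> parcs G)"

definition independence_number :: "'a pair_pre_digraph \<Rightarrow> nat" where
  "independence_number G = Max (card ` {S. independent_set G S})"

definition terminal_pairs ::
  "nat \<Rightarrow> 'a pair_pre_digraph \<Rightarrow> 'a list \<Rightarrow> 'a list \<Rightarrow> bool" where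
  "terminal_pairs l G s t \<longleftrightarrow>
     length s = l \<and> length t = l \<and> distinct (s @ t) \<and> set (s @ t) \<subseteq> pverts G"

definition spanning_linkage ::
  "nat \<Rightarrow> 'a pair_pre_digraph \<Rightarrow> 'a list \<Rightarrow> 'a list \<Rightarrow> (nat \<Rightarrow> 'a list) \<Rightarrow> bool" where
  "spanning_linkage l G s t P \<longleftrightarrow>
     (\<forall>i<l. vpath (P i) (with_proj G) \<and> hd (P i) = s ! i \<and> last (P i) = t ! i) \<and>
     (\<forall>i<l. \<forall>j<l. i \<noteq> j \<longrightarrow> set (P i) \<inter> set (P j) = {}) \<and>
     (\<Union>i<l. set (P i)) = pverts G"

definition hamiltonian_linked :: "nat \<Rightarrow> 'a pair_pre_digraph \<Rightarrow> bool" where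
  "hamiltonian_linked l G \<longleftrightarrow>
     2 * l \<le> card (pverts G) \<and>
     (\<forall>s t. terminal_pairs l G s t \<longrightarrow> (\<exists>P. spanning_linkage l G s t P))"

definition has_path_cover :: "nat \<Rightarrow> 'a pair_pre_digraph \<Rightarrow> bool" where
  "has_path_cover l G \<longleftrightarrow>
     (\<exists>s t. terminal_pairs l G s t \<and> (\<exists>P. spanning_linkage l G s t P))"


section \<open>Random access machines\<close>

text \<open>
  A random access machine has registers \<open>M 0, M 1, \<dots>\<close> holding natural numbers and a
  read-only input word. Every instruction costs one time unit. Since the only arithmetic
  operations are addition and truncated subtraction, the largest register content at most
  doubles per step (beyond the constants of the program and the input bits), so running time
  in this model agrees with that of Turing machines up to a polynomial.
\<close>

datatype instr =
    Const nat nat        \<comment> \<open>\<open>M r := c\<close>\<close>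
  | Add nat nat nat      \<comment> \<open>\<open>M r := M a + M b\<close>\<close>
  | Sub nat nat nat      \<comment> \<open>\<open>M r := M a - M b\<close>, truncated at 0\<close>
  | Load nat nat         \<comment> \<open>\<open>M r := M (M a)\<close>\<close>
  | Store nat nat        \<comment> \<open>\<open>M (M a) := M b\<close>\<close>
  | Read nat nat         \<comment> \<open>\<open>M r :=\<close> input symbol at position \<open>M a\<close>\<close>
  | Jump nat
  | JumpZero nat nat     \<comment> \<open>jump to the second argument if \<open>M r = 0\<close>\<close>

type_synonym program = "instr list"
type_synonym config = "nat \<times> (nat \<Rightarrow> nat)"

text \<open>
  The value read distinguishes the two letters from positions beyond the end of the input, so
  that the length of the input is accessible.
\<close>

definition input_symbol :: "bool list \<Rightarrow> nat \<Rightarrow> nat" where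
  "input_symbol w i = (if i < length w then (if w ! i then 2 else 1) else 0)"

fun exec :: "bool list \<Rightarrow> instr \<Rightarrow> config \<Rightarrow> config" where
  "exec w (Const r c) (pc, M) = (Suc pc, M(r := c))"
| "exec w (Add r a b) (pc, M) = (Suc pc, M(r := M a + M b))"
| "exec w (Sub r a b) (pc, M) = (Suc pc, M(r := M a - M b))"
| "exec w (Load r a) (pc, M) = (Suc pc, M(r := M (M a)))"
| "exec w (Store a b) (pc, M) = (Suc pc, M(M a := M b))"
| "exec w (Read r a) (pc, M) = (Suc pc, M(r := input_symbol w (M a)))"
| "exec w (Jump q) (pc, M) = (q, M)"
| "exec w (JumpZero r q) (pc, M) = (if M r = 0 then q else Suc pc, M)"

text \<open>
  The machine halts when the program counter leaves the program; halted configurations are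
  fixed points of the step function.
\<close>

definition halted :: "program \<Rightarrow> config \<Rightarrow> bool" where
  "halted prog c \<longleftrightarrow> length prog \<le> fst c"

definition step :: "program \<Rightarrow> bool list \<Rightarrow> config \<Rightarrow> config" where
  "step prog w c = (if halted prog c then c else exec w (prog ! fst c) c)"

definition run :: "program \<Rightarrow> bool list \<Rightarrow> nat \<Rightarrow> config" where
  "run prog w n = (step prog w ^^ n) (0, \<lambda>_. 0)"

definition accepting :: "config \<Rightarrow> bool" where
  "accepting c \<longleftrightarrow> snd c 0 \<noteq> 0"

text \<open>
  A decision problem \<open>Q\<close> is solvable in polynomial time on the inputs from a class \<open>C\<close> if one
  program halts with the correct answer on every input from \<open>C\<close>, within a number of steps
  bounded by a polynomial in the length of the encoding. Nothing is required of its behaviour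
  on inputs outside \<open>C\<close>.
\<close>

definition poly_time_solvable_on ::
  "('a \<Rightarrow> bool list) \<Rightarrow> 'a set \<Rightarrow> ('a \<Rightarrow> bool) \<Rightarrow> bool" where
  "poly_time_solvable_on enc C Q \<longleftrightarrow>
     (\<exists>prog (p :: nat poly). \<forall>x\<in>C. \<exists>n \<le> poly p (length (enc x)).
        halted prog (run prog (enc x) n) \<and> (accepting (run prog (enc x) n) \<longleftrightarrow> Q x))"


section \<open>Graphs as inputs\<close>

definition input_graphs :: "nat pair_pre_digraph set" where
  "input_graphs = {G. pair_graph G \<and> (\<exists>n. pverts G = {..<n})}"

text \<open>
  A graph on \<open>{..<n}\<close> is encoded by \<open>n\<close> in unary, a separator, and the rows of its adjacency
  matrix.
\<close>

definition encode_graph :: "nat pair_pre_digraph \<Rightarrow> bool list" where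
  "encode_graph G =
     (let n = card (pverts G)
      in replicate n True @ [False] @
         concat (map (\<lambda>i. map (\<lambda>j. (i, j) \<in> parcs G) [0..<n]) [0..<n]))"

end

theory Submission
  imports Defs
begin

text \<open>
  The existence of a spanning linkage between given terminals is first-order definable on graphs of
  independence number less than \<open>k\<close>, and a first-order property is decided by nested loops over the
  vertices, one for each quantifier.

  For definability, call \<open>X\<close> robust if deleting few further vertices does not disconnect any component
  of \<open>G - X\<close>. A robust \<open>X\<close> of bounded size exists: as long as \<open>X\<close> is not robust, a small separator can
  be added to it, which increases the number of components, and there are fewer than \<open>k\<close> components.
  A spanning linkage then exists if and only if there is a linkage of bounded size that covers \<open>X\<close> and
  has two consecutive vertices in every component of \<open>G - X\<close> that it does not cover. Given a spanning
  linkage, the part of a path between two visits to \<open>X\<close> is replaced by a shortest detour, and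
  shortest paths are induced, hence have at most \<open>2 k\<close> vertices. Conversely, such a linkage is extended
  to a spanning one by the rotation argument of Chvatal and Erdos. Connectivity is definable because
  shortest paths have bounded length.
\<close>


section \<open>Connectivity outside a vertex set\<close>

text \<open>Two demands conflict: \<open>X\<close> must tolerate the deletion of a whole
  certificate, yet certificates grow with \<open>card X\<close>. The bounds are therefore fixed by
  stages before \<open>X\<close> is known: stage \<open>j\<close> allows
  \<open>deletion_bound k l j\<close> vertices and asks for a robustness computed from that number.
  A failure gains a component and leads to the next stage, so some stage below \<open>k\<close>
  succeeds. All bounds depend on \<open>k\<close> and \<open>l\<close> alone, and so does the number
  of nested loops.

  A consecutive pair is the least trace that a path must leave in an uncovered component. If few
  covered vertices have a neighbour in the uncovered part \<open>W\<close>, robustness forces both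
  vertices of the pair to be among them, and \<open>W\<close> is inserted between the two. If there
  are many, the independence bound permits a rotation.

  In the other direction, paths are first shortened with respect to the coarser relation
  \<open>jump\<close>, which ignores how a component of \<open>G - X\<close> is traversed;
  robustness then turns each jump into a real path that is disjoint from the rest.\<close>

abbreviation adj :: "'a pair_pre_digraph \<Rightarrow> 'a \<Rightarrow> 'a \<Rightarrow> bool" where
  "adj G u v \<equiv> (u, v) \<in> parcs G"

definition walk_avoiding :: "'a pair_pre_digraph \<Rightarrow> 'a set \<Rightarrow> 'a list \<Rightarrow> bool" where
  "walk_avoiding G X p \<longleftrightarrow> p \<noteq> [] \<and> set p \<subseteq> pverts G - X \<and> successively (adj G) p"

definition joined :: "'a pair_pre_digraph \<Rightarrow> 'a set \<Rightarrow> 'a \<Rightarrow> 'a \<Rightarrow> bool" where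
  "joined G X u v \<longleftrightarrow> (\<exists>p. walk_avoiding G X p \<and> hd p = u \<and> last p = v)"

definition robust :: "'a pair_pre_digraph \<Rightarrow> 'a set \<Rightarrow> nat \<Rightarrow> bool" where
  "robust G X c \<longleftrightarrow> X \<subseteq> pverts G \<and> (\<forall>S u v. S \<subseteq> pverts G \<longrightarrow> card S \<le> c \<longrightarrow> u \<notin> S \<longrightarrow> v \<notin> S \<longrightarrow>
     joined G X u v \<longrightarrow> joined G (X \<union> S) u v)"

lemma not_successively_iff:
  "\<not> successively R p \<longleftrightarrow> (\<exists>a x y b. p = a @ [x, y] @ b \<and> \<not> R x y)"
proof
  show "\<not> successively R p \<Longrightarrow> \<exists>a x y b. p = a @ [x, y] @ b \<and> \<not> R x y"
  proof (induction R p rule: successively.induct)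
    case (3 P x y xs)
    show ?case
    proof (cases "P x y")
      case True
      then obtain a u v b where "y # xs = a @ [u, v] @ b" "\<not> P u v" using 3 by auto
      then have "x # y # xs = (x # a) @ [u, v] @ b \<and> \<not> P u v" by simp
      then show ?thesis by blast
    next
      case False
      then have "x # y # xs = [] @ [x, y] @ xs \<and> \<not> P x y" by simp
      then show ?thesis by blast
    qed
  qed auto
qed (auto simp: successively_append_iff)

lemma joinedD: "joined G X u v \<Longrightarrow> u \<in> pverts G - X \<and> v \<in> pverts G - X"
  using hd_in_set last_in_set unfolding joined_def walk_avoiding_def by blast

lemma joined_refl: "u \<in> pverts G - X \<Longrightarrow> joined G X u u"
  unfolding joined_def walk_avoiding_def by (rule exI[of _ "[u]"]) auto

lemma joined_adj: "adj G u v \<Longrightarrow> u \<in> pverts G - X \<Longrightarrow> v \<in> pverts G - X \<Longrightarrow> joined G X u v"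
  unfolding joined_def walk_avoiding_def by (rule exI[of _ "[u, v]"]) auto

lemma joined_trans:
  assumes "joined G X u v" "joined G X v w"
  shows "joined G X u w"
proof -
  obtain p where p: "walk_avoiding G X p" "hd p = u" "last p = v"
    using assms by (auto simp: joined_def)
  obtain q where q: "walk_avoiding G X q" "hd q = v" "last q = w"
    using assms by (auto simp: joined_def)
  obtain q' where q': "q = v # q'" using q by (cases q) (auto simp: walk_avoiding_def)
  have "walk_avoiding G X (p @ q')"
    using p q q' by (auto simp: walk_avoiding_def successively_append_iff successively_Cons)
  moreover have "hd (p @ q') = u" "last (p @ q') = w"
    using p q q' by (auto simp: walk_avoiding_def)
  ultimately show ?thesis unfolding joined_def by blast
qed

lemma joined_mono: "joined G X u v \<Longrightarrow> Y \<subseteq> X \<Longrightarrow> joined G Y u v"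
  unfolding joined_def walk_avoiding_def by blast

lemma joined_hd:
  assumes "walk_avoiding G X p" "z \<in> set p"
  shows "joined G X (hd p) z"
proof -
  obtain a b where p: "p = a @ z # b" using assms(2) by (meson split_list)
  have "walk_avoiding G X (a @ [z])"
    using assms(1) p by (auto simp: walk_avoiding_def successively_append_iff)
  moreover have "hd (a @ [z]) = hd p" using p by (cases a) auto
  ultimately show ?thesis unfolding joined_def by fastforce
qed


section \<open>Linkages\<close>

text \<open>
  The relation \<open>R\<close> between consecutive vertices is adjacency, or a coarser relation when a path is
  allowed to jump within a component.
\<close>

definition linkage ::
  "('a \<Rightarrow> 'a \<Rightarrow> bool) \<Rightarrow> 'a set \<Rightarrow> nat \<Rightarrow> 'a list \<Rightarrow> 'a list \<Rightarrow> (nat \<Rightarrow> 'a list) \<Rightarrow> bool" where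
  "linkage R V l s t P \<longleftrightarrow>
     (\<forall>i<l. P i \<noteq> [] \<and> distinct (P i) \<and> set (P i) \<subseteq> V \<and> successively R (P i) \<and>
            hd (P i) = s ! i \<and> last (P i) = t ! i) \<and>
     (\<forall>i<l. \<forall>j<l. i \<noteq> j \<longrightarrow> set (P i) \<inter> set (P j) = {})"

definition covered :: "nat \<Rightarrow> (nat \<Rightarrow> 'a list) \<Rightarrow> 'a set" where
  "covered l P = (\<Union>i<l. set (P i))"

text \<open>Negating \<open>successively\<close> expresses that some consecutive pair of
  \<open>p\<close> lies in the component of \<open>w\<close>, and lets
  \<open>successively_append_iff\<close> trace such pairs through paths that are cut and
  reassembled.\<close>

definition enters :: "'a pair_pre_digraph \<Rightarrow> 'a set \<Rightarrow> 'a \<Rightarrow> 'a list \<Rightarrow> bool" where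
  "enters G X w p \<longleftrightarrow> \<not> successively (\<lambda>u v. \<not> (joined G X w u \<and> joined G X w v)) p"

text \<open>Here \<open>w\<close> stands for its component in \<open>G - X\<close>, a component being given by any of its vertices.\<close>

definition seed :: "'a pair_pre_digraph \<Rightarrow> 'a set \<Rightarrow> nat \<Rightarrow> (nat \<Rightarrow> 'a list) \<Rightarrow> bool" where
  "seed G X l P \<longleftrightarrow> X \<subseteq> covered l P \<and>
     (\<forall>w\<in>pverts G - X. w \<in> covered l P \<or>
        (\<exists>i<l. enters G X w (P i)))"

lemma vwalk_arcs_subset_iff: "set (vwalk_arcs p) \<subseteq> A \<longleftrightarrow> successively (\<lambda>u v. (u, v) \<in> A) p"
  by (induction p rule: vwalk_arcs.induct) auto

lemma spanning_linkage_iff: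
  "spanning_linkage l G s t P \<longleftrightarrow> linkage (adj G) (pverts G) l s t P \<and> covered l P = pverts G"
  unfolding spanning_linkage_def linkage_def covered_def vpath_def vwalk_def
  by (auto simp: vwalk_arcs_subset_iff)

text \<open>The basic surgery on a linkage: as the paths are disjoint,
  \<open>covered l P - set (P i)\<close> contains all the others, so this is the set that
  \<open>q\<close> has to avoid.\<close>

lemma linkage_fun_upd:
  assumes "linkage R V l s t P" "i < l" "q \<noteq> []" "distinct q" "set q \<subseteq> V" "successively R q"
    "hd q = hd (P i)" "last q = last (P i)" "set q \<inter> (covered l P - set (P i)) = {}"
  shows "linkage R V l s t (P(i := q))"
proof -
  have "set q \<inter> set (P j) = {}" if "j < l" "j \<noteq> i" for j
  proof -
    have "set (P j) \<subseteq> covered l P - set (P i)"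
      using assms(1,2) that unfolding linkage_def covered_def by blast
    then show ?thesis using assms(9) by blast
  qed
  then show ?thesis using assms unfolding linkage_def by (auto simp: Int_commute)
qed

lemma linkage_coarsen:
  assumes "linkage R V l s t P" "\<And>i. i < l \<Longrightarrow> successively Q (P i)"
  shows "linkage Q V l s t P"
  using assms unfolding linkage_def by blast

lemma covered_fun_upd_superset:
  "i < l \<Longrightarrow> set (P i) \<subseteq> set q \<Longrightarrow> covered l (P(i := q)) = covered l P \<union> set q"
proof -
  assume *: "i < l" "set (P i) \<subseteq> set q"
  then have "covered l P = set (P i) \<union> (\<Union>j\<in>{..<l} - {i}. set (P j))"
    unfolding covered_def by blast
  moreover have "covered l (P(i := q)) = set q \<union> (\<Union>j\<in>{..<l} - {i}. set (P j))"
    using * unfolding covered_def by (auto split: if_splits)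
  ultimately show ?thesis using *(2) by blast
qed

lemma covered_fun_upd_lower:
  assumes "i < l"
  shows "covered l P - set (P i) \<union> set q \<subseteq> covered l (P(i := q))"
proof
  fix x assume "x \<in> covered l P - set (P i) \<union> set q"
  then consider j where "j < l" "j \<noteq> i" "x \<in> set (P j)" | "x \<in> set q"
    unfolding covered_def by blast
  then show "x \<in> covered l (P(i := q))"
    using assms unfolding covered_def by cases auto
qed

lemma linkage_covered_subset: "linkage R V l s t P \<Longrightarrow> covered l P \<subseteq> V"
  unfolding linkage_def covered_def by blast

lemma finite_covered: "finite (covered l P)"
  by (simp add: covered_def)

lemma card_covered_le: "card (covered l P) \<le> (\<Sum>i<l. length (P i))"
  unfolding covered_def
  by (rule order_trans[OF card_UN_le]) (auto intro!: sum_mono card_length)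

section \<open>Shortest walks in graphs of bounded independence number\<close>

locale bounded_independence = pair_graph G for G :: "'a pair_pre_digraph" +
  fixes k :: nat
  assumes indep: "independent_set G I \<Longrightarrow> card I < k"
begin

lemma adj_sym: "adj G u v \<Longrightarrow> adj G v u"
  using pair_sym_arcs by (auto simp: symmetric_def sym_def)

lemma adj_irrefl: "\<not> adj G u u"
  using pair_no_loops by fastforce

lemma adjD: "adj G u v \<Longrightarrow> u \<in> pverts G \<and> v \<in> pverts G"
  using in_arcsD1 in_arcsD2 by blast

lemma joined_sym:
  assumes "joined G X u v"
  shows "joined G X v u"
proof -
  obtain p where p: "walk_avoiding G X p" "hd p = u" "last p = v"
    using assms by (auto simp: joined_def)
  have "successively (\<lambda>x y. adj G y x) p"
    using p(1) by (auto simp: walk_avoiding_def intro: successively_mono adj_sym)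
  then have "walk_avoiding G X (rev p)" "hd (rev p) = v" "last (rev p) = u"
    using p by (auto simp: walk_avoiding_def hd_rev last_rev)
  then show ?thesis unfolding joined_def by blast
qed

lemma joined_cong:
  assumes "joined G X u v"
  shows "joined G X u z \<longleftrightarrow> joined G X v z" "joined G X z u \<longleftrightarrow> joined G X z v"
  using assms joined_trans[of G X u v z] joined_trans[of G X v u z] joined_trans[of G X z u v]
    joined_trans[of G X z v u] joined_sym[of X u v] by blast+

text \<open>A shortest walk is an induced path, and every other vertex of it is independent.\<close>

lemma joined_short:
  assumes "joined G X u v"
  obtains p where "walk_avoiding G X p" "hd p = u" "last p = v" "distinct p" "length p \<le> 2 * k"
proof -
  define W where "W p \<longleftrightarrow> walk_avoiding G X p \<and> hd p = u \<and> last p = v" for p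
  obtain p0 where "W p0" using assms by (auto simp: joined_def W_def)
  define p where "p = arg_min length W"
  have p: "W p" and min: "\<And>q. W q \<Longrightarrow> length p \<le> length q"
    using arg_min_natI[of W p0 length] arg_min_nat_le[of W _ length] \<open>W p0\<close>
    by (auto simp: p_def)
  have suc: "adj G (p ! i) (p ! Suc i)" if "Suc i < length p" for i
    using p that by (auto simp: W_def walk_avoiding_def successively_conv_nth)
  have no_short: "\<not> adj G (p ! i) (p ! j)" if ij: "Suc i < j" "j < length p" for i j
  proof
    assume a: "adj G (p ! i) (p ! j)"
    let ?q = "take (Suc i) p @ drop j p"
    have "W ?q" unfolding W_def walk_avoiding_def
    proof (intro conjI)
      show "?q \<noteq> []" using ij by simp
      show "set ?q \<subseteq> pverts G - X"
        using p set_take_subset[of "Suc i" p] set_drop_subset[of j p]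
        by (auto simp: W_def walk_avoiding_def)
      have "successively (adj G) (take (Suc i) p @ drop (Suc i) p)"
        "successively (adj G) (take j p @ drop j p)"
        using p by (auto simp: W_def walk_avoiding_def)
      then have "successively (adj G) (take (Suc i) p)" "successively (adj G) (drop j p)"
        using successively_append_iff by blast+
      moreover have "last (take (Suc i) p) = p ! i" "hd (drop j p) = p ! j"
        using ij by (auto simp: take_Suc_conv_app_nth hd_drop_conv_nth)
      ultimately show "successively (adj G) ?q" using a by (simp add: successively_append_iff)
      show "hd ?q = u" using p ij by (cases p) (auto simp: W_def)
      show "last ?q = v" using p ij by (auto simp: W_def)
    qed
    from min[OF this] ij show False by simp
  qed
  have dist: "distinct p"
  proof (rule ccontr)
    assume "\<not> distinct p"
    then obtain i j where ij: "i < j" "j < length p" "p ! i = p ! j"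
      by (metis distinct_conv_nth linorder_neqE_nat)
    let ?q = "take i p @ drop j p"
    have "W ?q" unfolding W_def walk_avoiding_def
    proof (intro conjI)
      show "?q \<noteq> []" using ij by simp
      show "set ?q \<subseteq> pverts G - X"
        using p set_take_subset[of i p] set_drop_subset[of j p]
        by (auto simp: W_def walk_avoiding_def)
      have "successively (adj G) (take i p @ drop i p)"
        "successively (adj G) (take j p @ drop j p)"
        using p by (auto simp: W_def walk_avoiding_def)
      then have "successively (adj G) (take i p)" "successively (adj G) (drop j p)"
        "take i p = [] \<or> drop i p = [] \<or> adj G (last (take i p)) (hd (drop i p))"
        unfolding successively_append_iff by blast+
      moreover have "drop i p \<noteq> []" using ij by simp
      moreover have "hd (drop j p) = hd (drop i p)" using ij by (simp add: hd_drop_conv_nth)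
      ultimately show "successively (adj G) ?q" by (auto simp: successively_append_iff)
      show "hd ?q = u"
      proof (cases i)
        case 0
        then show ?thesis using p ij hd_conv_nth[of p]
          by (auto simp: W_def walk_avoiding_def hd_drop_conv_nth)
      next
        case (Suc m)
        then show ?thesis using p ij by (cases p) (auto simp: W_def)
      qed
      show "last ?q = v" using p ij by (auto simp: W_def)
    qed
    from min[OF this] ij show False by simp
  qed
  \<comment> \<open>Distinct even positions are never successive, so \<open>no_short\<close> applies
    to each pair; by \<open>dist\<close> these are \<open>(length p + 1) div 2\<close>
    vertices.\<close>
  define I where "I = (\<lambda>i. p ! (2 * i)) ` {i. 2 * i < length p}"
  have "independent_set G I"
    unfolding independent_set_def
  proof (intro conjI ballI notI)
    show "I \<subseteq> pverts G"
      using p nth_mem unfolding I_def W_def walk_avoiding_def by blast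
    fix x y assume "x \<in> I" "y \<in> I" and a: "adj G x y"
    then obtain i j where ij: "2 * i < length p" "2 * j < length p" "x = p ! (2 * i)" "y = p ! (2 * j)"
      by (auto simp: I_def)
    consider "i = j" | "i < j" | "j < i" by linarith
    then show False
      by cases (use a ij adj_irrefl adj_sym no_short[of "2*i" "2*j"] no_short[of "2*j" "2*i"] in auto)
  qed
  then have "card I < k" by (rule indep)
  moreover have "card I = card {i. 2 * i < length p}"
    unfolding I_def by (rule card_image) (auto intro!: inj_onI simp: nth_eq_iff_index_eq[OF dist])
  moreover have "{i. 2 * i < length p} = {..<(length p + 1) div 2}" by auto
  ultimately have "length p \<le> 2 * k" by simp
  then show ?thesis using that p dist unfolding W_def by blast
qed


section \<open>Extending a seed to a spanning linkage\<close>

lemma walk_stays: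
  assumes "successively (adj G) p" "p \<noteq> []" "hd p \<in> W" "set p \<subseteq> pverts G"
    and "\<And>x y. x \<in> W \<Longrightarrow> adj G x y \<Longrightarrow> y \<in> set p \<Longrightarrow> y \<in> W"
  shows "set p \<subseteq> W"
  using assms
proof (induction p)
  case (Cons x p)
  show ?case
  proof (cases "p = []")
    case False
    then have "hd p \<in> W" using Cons.prems by (simp add: successively_Cons)
    moreover have "successively (adj G) p" using Cons.prems False by (simp add: successively_Cons)
    ultimately have "set p \<subseteq> W" using Cons.IH[OF _ False] Cons.prems by auto
    then show ?thesis using Cons.prems by simp
  qed (use Cons.prems in simp)
qed simp

text \<open>Common end of both cases of the extension. In \<open>pair\<close>, the set
  \<open>R\<close> plays a component of \<open>G - X\<close>: it absorbs every neighbour in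
  \<open>W\<close>, because \<open>W\<close> misses \<open>covered l P\<close> and hence
  \<open>X\<close>. A consecutive pair that the old path has in \<open>R\<close> must reappear on
  \<open>q\<close>, so the seed property survives.\<close>

lemma augment:
  assumes P: "linkage (adj G) (pverts G) l s t P" "seed G X l P" and i: "i < l"
    and W: "W \<inter> covered l P = {}"
    and q: "distinct q" "set q = set (P i) \<union> Q" "Q \<noteq> {}" "Q \<subseteq> W" "W \<subseteq> pverts G"
      "successively (adj G) q" "hd q = hd (P i)" "last q = last (P i)"
    and pair: "\<And>R. (\<And>x y. x \<in> R \<Longrightarrow> y \<in> W \<Longrightarrow> adj G x y \<Longrightarrow> y \<in> R) \<Longrightarrow>
      successively (\<lambda>u v. \<not> (u \<in> R \<and> v \<in> R)) q \<Longrightarrow> successively (\<lambda>u v. \<not> (u \<in> R \<and> v \<in> R)) (P i)"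
  shows "\<exists>P'. linkage (adj G) (pverts G) l s t P' \<and> seed G X l P' \<and> covered l P \<subset> covered l P'"
proof -
  let ?P = "P(i := q)"
  have sub: "set (P i) \<subseteq> set q" using q(2) by auto
  have "set (P i) \<subseteq> pverts G" using P(1) i by (auto simp: linkage_def)
  then have "linkage (adj G) (pverts G) l s t ?P"
    using q W by (intro linkage_fun_upd[OF P(1) i]) auto
  moreover have cov: "covered l ?P = covered l P \<union> Q"
    using covered_fun_upd_superset[of i l P q] i q(2) unfolding covered_def by blast
  moreover have "seed G X l ?P"
    unfolding seed_def
  proof (intro conjI ballI)
    show "X \<subseteq> covered l ?P" using P(2) cov by (auto simp: seed_def)
    fix w assume w: "w \<in> pverts G - X"
    show "w \<in> covered l ?P \<or>
      (\<exists>i<l. enters G X w (?P i))"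
    proof (cases "w \<in> covered l P")
      case False
      then obtain j where j: "j < l"
        "enters G X w (P j)"
        using P(2) w unfolding seed_def by blast
      show ?thesis
      proof (cases "j = i")
        case True
        have "joined G X w y" if "joined G X w x" "y \<in> W" "adj G x y" for x y
        proof -
          have "y \<in> pverts G - X" using that W P(2) q(5) by (auto simp: seed_def)
          then show ?thesis
            using joined_trans[OF that(1) joined_adj[OF that(3)]] joinedD[OF that(1)] by blast
        qed
        then have "enters G X w q"
          using pair[of "Collect (joined G X w)"] j(2) True by (auto simp: enters_def)
        then show ?thesis using i by (intro disjI2 exI[of _ i]) simp
      qed (use j in \<open>auto intro!: exI[of _ j]\<close>)
    qed (use cov in auto)
  qed
  moreover have "covered l P \<subset> covered l ?P" using cov q(3,4) W by blast
  ultimately show ?thesis by blast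
qed

text \<open>
  The rotation argument of Chvatal and Erdos: \<open>W\<close> is a component of the uncovered part. If two
  consecutive vertices of a path have neighbours in \<open>W\<close>, the path can be extended through \<open>W\<close>.
  Otherwise, many vertices of one path have neighbours in \<open>W\<close>; two of their successors \<open>x'\<close>, \<open>y'\<close>
  are adjacent, and \<open>\<dots> x x' \<dots> y y' \<dots>\<close> is replaced by \<open>\<dots> x W y \<dots> x' y' \<dots>\<close>.
\<close>

lemma seed_extend:
  assumes P: "linkage (adj G) (pverts G) l s t P" "seed G X l P" and X: "robust G X c" "l * k \<le> c"
    and w: "w \<in> pverts G" "w \<notin> covered l P"
  shows "\<exists>P'. linkage (adj G) (pverts G) l s t P' \<and> seed G X l P' \<and> covered l P \<subset> covered l P'"
proof -
  define C where "C = covered l P"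
  define W where "W = {x. joined G C w x}"
  define N where "N = {x \<in> C. \<exists>a\<in>W. adj G x a}"
  have CV: "C \<subseteq> pverts G" using P(1) by (auto simp: C_def covered_def linkage_def)
  have wW: "w \<in> W" using w by (auto simp: W_def C_def joined_refl)
  have W: "W \<inter> covered l P = {}" "W \<subseteq> pverts G" using joinedD by (fastforce simp: W_def C_def)+
  have through: "\<exists>q. q \<noteq> [] \<and> distinct q \<and> set q \<subseteq> W \<and> successively (adj G) q \<and>
      adj G x (hd q) \<and> adj G (last q) y" if N: "x \<in> N" "y \<in> N" for x y
  proof -
    obtain a where a: "a \<in> W" "adj G x a" using N(1) unfolding N_def by blast
    obtain b where b: "b \<in> W" "adj G y b" using N(2) unfolding N_def by blast
    note ab = a b
    then have w: "joined G C w a" "joined G C w b" by (auto simp: W_def)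
    then have "joined G C a b" using joined_trans[OF joined_sym] by blast
    then obtain q where q: "walk_avoiding G C q" "hd q = a" "last q = b" "distinct q"
      using joined_short by metis
    have "set q \<subseteq> W"
      using joined_trans[OF w(1)] joined_hd[OF q(1)] q(2) by (auto simp: W_def)
    then show ?thesis
      using q a(2) adj_sym[OF b(2)] unfolding walk_avoiding_def by (intro exI[of _ q]) simp
  qed
  show ?thesis
  proof (cases "\<exists>i<l. \<exists>a x y b. P i = a @ [x, y] @ b \<and> x \<in> N \<and> y \<in> N")
    case True
    then obtain i a x y b where i: "i < l" "P i = a @ [x, y] @ b" "x \<in> N" "y \<in> N" by blast
    obtain q where q: "q \<noteq> []" "distinct q" "set q \<subseteq> W" "successively (adj G) q"
      "adj G x (hd q)" "adj G (last q) y" using through[OF i(3,4)] by blast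
    have Pi: "distinct (P i)" "successively (adj G) (P i)" "set (P i) \<subseteq> covered l P"
      using P(1) i(1) by (auto simp: linkage_def covered_def)
    show ?thesis
    proof (rule augment[OF P i(1) W(1), of "a @ [x] @ q @ [y] @ b" "set q"])
      show "distinct (a @ [x] @ q @ [y] @ b)"
        using Pi q W(1) i(2) by auto
      show "successively (adj G) (a @ [x] @ q @ [y] @ b)"
        using Pi q i(2) by (auto simp: successively_append_iff successively_Cons)
      show "hd (a @ [x] @ q @ [y] @ b) = hd (P i)" using i(2) by (cases a) auto
      show "last (a @ [x] @ q @ [y] @ b) = last (P i)" using i(2) by auto
      fix R assume R: "\<And>x y. x \<in> R \<Longrightarrow> y \<in> W \<Longrightarrow> adj G x y \<Longrightarrow> y \<in> R"
        and suc: "successively (\<lambda>u v. \<not> (u \<in> R \<and> v \<in> R)) (a @ [x] @ q @ [y] @ b)"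
      \<comment> \<open>The only pair that disappears is \<open>x, y\<close>. It does not lie in
        \<open>R\<close>, as otherwise \<open>x, hd q\<close> would be a pair of the new path in
        \<open>R\<close>.\<close>
      have "hd q \<in> W" "last q \<in> W" using q(1,3) by auto
      then have "x \<notin> R"
        using R[of x "hd q"] suc q by (auto simp: successively_append_iff successively_Cons)
      then show "successively (\<lambda>u v. \<not> (u \<in> R \<and> v \<in> R)) (P i)"
        using suc i(2) by (auto simp: successively_append_iff successively_Cons)
    qed (use i(2) q W in auto)
  next
    case False
    \<comment> \<open>If \<open>N\<close> were small, deleting it would not disconnect
      \<open>w\<close> from a vertex outside \<open>N\<close> in its component of
      \<open>G - X\<close>. But a walk from \<open>w\<close> avoiding \<open>N\<close> never leaves
      \<open>W\<close>, so all vertices of \<open>C\<close> in that component lie in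
      \<open>N\<close>. Among them is the consecutive pair promised by \<open>seed\<close>, which
      this case excludes.\<close>
    have "card N > l * k"
    proof (rule ccontr)
      assume "\<not> card N > l * k"
      then have cN: "card N \<le> c" using X(2) by simp
      have in_N: "z \<in> N" if z: "z \<in> C" "joined G X w z" for z
      proof (rule ccontr)
        assume "z \<notin> N"
        moreover have "N \<subseteq> pverts G" "w \<notin> N" using CV w by (auto simp: N_def C_def)
        ultimately have "joined G (X \<union> N) w z" using X(1) cN z(2) unfolding robust_def by blast
        then obtain p where p: "walk_avoiding G (X \<union> N) p" "hd p = w" "last p = z"
          by (auto simp: joined_def)
        have "set p \<subseteq> W"
        proof (rule walk_stays)
          fix x y assume xy: "x \<in> W" "adj G x y" "y \<in> set p"
          then have "y \<notin> C" using p(1) adj_sym by (auto simp: walk_avoiding_def N_def)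
          then have "joined G C x y"
            using xy adjD joinedD[of G C w x] by (intro joined_adj) (auto simp: W_def)
          moreover have "joined G C w x" using xy(1) by (simp add: W_def)
          ultimately show "y \<in> W" using joined_trans[of G C w x y] by (simp add: W_def)
        qed (use p wW in \<open>auto simp: walk_avoiding_def\<close>)
        then have "z \<in> W" using p last_in_set by (auto simp: walk_avoiding_def)
        then show False using W(1) z(1) by (auto simp: C_def)
      qed
      have "w \<notin> X" using P(2) w by (auto simp: seed_def)
      then obtain i where i: "i < l"
        "enters G X w (P i)"
        using P(2) w unfolding seed_def by blast
      then obtain a x y b where ab: "P i = a @ [x, y] @ b" "joined G X w x" "joined G X w y"
        unfolding enters_def not_successively_iff by blast
      have "x \<in> C" "y \<in> C" using ab(1) i(1) by (auto simp: C_def covered_def intro!: bexI[of _ i])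
      then show False using in_N ab i(1) False by blast
    qed
    have "\<exists>i<l. card (N \<inter> set (P i)) > k"
    proof (rule ccontr)
      assume "\<not> ?thesis"
      then have "(\<Sum>i<l. card (N \<inter> set (P i))) \<le> (\<Sum>i<l. k)" by (intro sum_mono) (meson lessThan_iff not_le)
      moreover have "N = (\<Union>i<l. N \<inter> set (P i))" by (auto simp: N_def C_def covered_def)
      then have "card N \<le> (\<Sum>i<l. card (N \<inter> set (P i)))" by (metis card_UN_le finite_lessThan)
      ultimately show False using \<open>card N > l * k\<close> by simp
    qed
    then obtain i where i: "i < l" and ci: "card (N \<inter> set (P i)) > k" by blast
    let ?p = "P i"
    have Pi: "distinct ?p" "successively (adj G) ?p" "set ?p \<subseteq> covered l P" "set ?p \<subseteq> pverts G"
      using P(1) i(1) by (auto simp: linkage_def covered_def)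
    define J where "J = {j. Suc j < length ?p \<and> ?p ! j \<in> N}"
    have finJ: "finite J" unfolding J_def by (rule finite_subset[of _ "{..<length ?p}"]) auto
    \<comment> \<open>The last vertex of the path has no successor; this costs at most one of the
      more than \<open>k\<close> vertices.\<close>
    have "N \<inter> set ?p \<subseteq> (!) ?p ` insert (length ?p - 1) J"
    proof
      fix x assume "x \<in> N \<inter> set ?p"
      then obtain j where "j < length ?p" "x = ?p ! j" "x \<in> N" by (auto simp: in_set_conv_nth)
      moreover from this have "j = length ?p - 1 \<or> j \<in> J" by (auto simp: J_def)
      ultimately show "x \<in> (!) ?p ` insert (length ?p - 1) J" by blast
    qed
    then have "card (N \<inter> set ?p) \<le> card (insert (length ?p - 1) J)"
      using finJ by (meson card_image_le card_mono finite.insertI finite_imageI le_trans)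
    also have "\<dots> \<le> Suc (card J)" by (rule card_insert_le_m1) auto
    finally have "k \<le> card J" using ci by simp
    moreover have "card ((\<lambda>j. ?p ! Suc j) ` J) = card J"
      by (rule card_image) (auto intro!: inj_onI simp: J_def nth_eq_iff_index_eq[OF Pi(1)])
    ultimately have "\<not> independent_set G ((\<lambda>j. ?p ! Suc j) ` J)" using indep by force
    moreover have "(\<lambda>j. ?p ! Suc j) ` J \<subseteq> pverts G" using Pi(4) by (auto simp: J_def)
    ultimately obtain j j' where "j \<in> J" "j' \<in> J" "adj G (?p ! Suc j) (?p ! Suc j')"
      unfolding independent_set_def by blast
    then have "\<exists>j\<in>J. \<exists>j'\<in>J. j < j' \<and> adj G (?p ! Suc j) (?p ! Suc j')"
      using adj_sym adj_irrefl by (metis linorder_neqE_nat)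
    then obtain j j' where jj: "j \<in> J" "j' \<in> J" "j < j'" "adj G (?p ! Suc j) (?p ! Suc j')" by blast
    \<comment> \<open>The segment \<open>m\<close> runs from position \<open>Suc j\<close> to
      \<open>j'\<close>. In the notation of the rotation above, \<open>hd m\<close> is
      \<open>x'\<close>, \<open>last m\<close> is \<open>y\<close> and \<open>?y\<close> is
      \<open>y'\<close>.\<close>
    define a m b where "a = take j ?p" and "m = take (j' - j) (drop (Suc j) ?p)"
      and "b = drop (Suc (Suc j')) ?p"
    let ?x = "?p ! j" and ?y = "?p ! Suc j'"
    have len: "Suc j' < length ?p" using jj by (simp add: J_def)
    have "?p = take (Suc j) ?p @ drop (Suc j) ?p" by simp
    also have "drop (Suc j) ?p = m @ drop (Suc j') ?p"
      using jj(3) append_take_drop_id[of "j' - j" "drop (Suc j) ?p"] by (simp add: m_def)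
    also have "drop (Suc j') ?p = ?y # b" using len by (simp add: b_def Cons_nth_drop_Suc)
    also have "take (Suc j) ?p = a @ [?x]" using len jj(3) by (simp add: a_def take_Suc_conv_app_nth)
    finally have p: "?p = a @ [?x] @ m @ [?y] @ b" by simp
    have m: "m \<noteq> []" "hd m = ?p ! Suc j" "last m = ?p ! j'"
      using len jj(3) by (auto simp: m_def hd_drop_conv_nth last_conv_nth)
    have "?x \<in> N" "last m \<in> N" using jj m by (auto simp: J_def)
    then obtain q where q: "q \<noteq> []" "distinct q" "set q \<subseteq> W" "successively (adj G) q"
      "adj G ?x (hd q)" "adj G (last q) (last m)" using through by blast
    obtain x y where xy: "x = ?x" "y = ?y" by blast
    note p = p[folded xy] and q = q[folded xy]
    have hm: "adj G (hd m) y" using jj(4) m(2) xy by simp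
    let ?q = "a @ [x] @ q @ rev m @ [y] @ b"
    show ?thesis
    proof (rule augment[OF P i(1) W(1), of ?q "set q"])
      show "distinct ?q"
        using Pi(1,3) q(2,3) W(1) unfolding p by auto
      have "successively (adj G) m" using Pi(2) m(1) unfolding p
        by (auto simp: successively_append_iff successively_Cons)
      then have "successively (adj G) (rev m)"
        unfolding successively_rev by (rule successively_mono) (auto intro: adj_sym)
      then show "successively (adj G) ?q"
        using Pi(2) q m(1) hm unfolding p
        by (auto simp: successively_append_iff successively_Cons hd_rev last_rev)
      show "hd ?q = hd ?p" by (subst p) (cases a; simp)
      show "last ?q = last ?p" by (subst p) simp
      fix R assume R: "\<And>x y. x \<in> R \<Longrightarrow> y \<in> W \<Longrightarrow> adj G x y \<Longrightarrow> y \<in> R"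
        and suc: "successively (\<lambda>u v. \<not> (u \<in> R \<and> v \<in> R)) ?q"
      \<comment> \<open>Reversal keeps the pairs inside \<open>m\<close>. The pairs lost are
        \<open>x, hd m\<close> and \<open>last m, y\<close>; if \<open>x\<close> or
        \<open>last m\<close> were in \<open>R\<close>, it would form a pair in \<open>R\<close>
        with its new neighbour in \<open>q\<close>.\<close>
      have "hd q \<in> W" "last q \<in> W" using q(1,3) by auto
      then have "x \<notin> R"
        using R[of x "hd q"] suc q by (auto simp: successively_append_iff successively_Cons)
      moreover have "last m \<notin> R"
        using R[of "last m" "last q"] suc q m(1) adj_sym \<open>last q \<in> W\<close>
        by (auto simp: successively_append_iff successively_Cons hd_rev)
      moreover have "successively (\<lambda>u v. \<not> (v \<in> R \<and> u \<in> R)) m"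
        using suc m(1) q(1) by (auto simp: successively_append_iff successively_Cons)
      then have "successively (\<lambda>u v. \<not> (u \<in> R \<and> v \<in> R)) m" by (rule successively_mono) auto
      ultimately show "successively (\<lambda>u v. \<not> (u \<in> R \<and> v \<in> R)) ?p"
        using suc m(1) unfolding p by (auto simp: successively_append_iff successively_Cons)
    next
      show "set ?q = set ?p \<union> set q" by (subst p) auto
    qed (use q W in auto)
  qed
qed

lemma seed_saturate:
  assumes "linkage (adj G) (pverts G) l s t P" "seed G X l P" and X: "robust G X c" "l * k \<le> c"
  shows "\<exists>P'. spanning_linkage l G s t P'"
  using assms(1,2)
proof (induction "card (pverts G - covered l P)" arbitrary: P rule: less_induct)
  case less
  show ?case
  proof (cases "pverts G \<subseteq> covered l P")
    case True
    moreover have "covered l P \<subseteq> pverts G" using less.prems(1) by (auto simp: covered_def linkage_def)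
    ultimately have "spanning_linkage l G s t P"
      unfolding spanning_linkage_iff using less.prems(1) by blast
    then show ?thesis by blast
  next
    case False
    then obtain w where "w \<in> pverts G" "w \<notin> covered l P" by blast
    from seed_extend[OF less.prems X this] obtain P' where P':
      "linkage (adj G) (pverts G) l s t P'" "seed G X l P'" "covered l P \<subset> covered l P'" by blast
    then have "covered l P' \<subseteq> pverts G" by (auto simp: covered_def linkage_def)
    then have "pverts G - covered l P' \<subset> pverts G - covered l P" using P'(3) by blast
    then have "card (pverts G - covered l P') < card (pverts G - covered l P)"
      using pair_finite_verts by (meson finite_Diff psubset_card_mono)
    from less.hyps[OF this P'(1,2)] show ?thesis .
  qed
qed

end


section \<open>A bounded certificate for spanning linkages\<close>

text \<open>Counts the detours that a path still owes; induction measure of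
  \<open>realise_jumps\<close>.\<close>

fun njumps :: "('a \<Rightarrow> 'a \<Rightarrow> bool) \<Rightarrow> 'a list \<Rightarrow> nat" where
  "njumps R (x # y # p) = (if R x y then 0 else 1) + njumps R (y # p)"
| "njumps R p = 0"

lemma njumps_append: "njumps R (a @ x # b) = njumps R (a @ [x]) + njumps R (x # b)"
proof (induction a)
  case (Cons c a)
  then show ?case by (cases a) auto
qed simp

lemma njumps_eq_0_iff: "njumps R p = 0 \<longleftrightarrow> successively R p"
  by (induction R p rule: njumps.induct) auto

lemma njumps_le_length: "njumps R p \<le> length p"
  by (induction R p rule: njumps.induct) auto

text \<open>Cut off three entries at a time: each block meets \<open>X\<close>, and at most two
  entries remain.\<close>

lemma length_le_if_triples_meet:
  assumes "\<And>a x y z b. p = a @ [x, y, z] @ b \<Longrightarrow> x \<in> X \<or> y \<in> X \<or> z \<in> X"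
  shows "length p \<le> 3 * length (filter (\<lambda>x. x \<in> X) p) + 2"
  using assms
proof (induction p rule: measure_induct_rule[of length])
  case (less p)
  show ?case
  proof (cases "length p \<le> 2")
    case False
    then obtain x y z q where p: "p = x # y # z # q"
      by (metis (no_types) Suc_le_length_iff not_less_eq_eq numeral_2_eq_2)
    have "x \<in> X \<or> y \<in> X \<or> z \<in> X" using less.prems[of "[]" x y z q] p by simp
    then have "length (filter (\<lambda>x. x \<in> X) p) \<ge> 1 + length (filter (\<lambda>x. x \<in> X) q)"
      unfolding p by auto
    moreover have tri: "u \<in> X \<or> v \<in> X \<or> w \<in> X" if "q = a @ [u, v, w] @ b" for a u v w b
      using less.prems[of "[x, y, z] @ a" u v w b] that p by simp
    have "length q \<le> 3 * length (filter (\<lambda>x. x \<in> X) q) + 2"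
      by (rule less.IH) (use p tri in auto)
    ultimately show ?thesis using p by simp
  qed simp
qed

lemma ex_fun_upd:
  fixes i l :: nat
  assumes "(\<exists>j<l. Q (P j)) \<or> Q q" "Q (P i) \<Longrightarrow> Q q" "i < l"
  shows "\<exists>j<l. Q ((P(i := q)) j)"
  using assms by (metis fun_upd_apply)

text \<open>Under this relation a component of \<open>G - X\<close> behaves like a complete graph,
  so a visit to it can be shortened freely.\<close>

definition jump :: "'a pair_pre_digraph \<Rightarrow> 'a set \<Rightarrow> 'a \<Rightarrow> 'a \<Rightarrow> bool" where
  "jump G X u v \<longleftrightarrow> adj G u v \<or> joined G X u v"

lemma sum_fun_upd:
  fixes l :: nat
  assumes "i < l"
  shows "(\<Sum>j<l. f ((P(i := q)) j) :: nat) + f (P i) = (\<Sum>j<l. f (P j)) + f q"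
proof -
  have "(\<Sum>j<l. f ((P(i := q)) j)) = f q + (\<Sum>j\<in>{..<l} - {i}. f (P j))"
    using assms by (simp add: sum.remove[of "{..<l}" i])
  moreover have "(\<Sum>j<l. f (P j)) = f (P i) + (\<Sum>j\<in>{..<l} - {i}. f (P j))"
    using assms by (simp add: sum.remove[of "{..<l}" i])
  ultimately show ?thesis by simp
qed

text \<open>
  With at most \<open>x\<close> vertices in \<open>X\<close>, a path without three consecutive vertices outside \<open>X\<close> has length
  at most \<open>3 x + 2\<close>, and replacing one jump adds at most \<open>2 k\<close> vertices.
\<close>

definition seed_bound :: "nat \<Rightarrow> nat \<Rightarrow> nat \<Rightarrow> nat" where
  "seed_bound k l x = (2 * k + 1) * (l * (3 * x + 2))"

text \<open>A detour has to avoid a linkage of total length at most \<open>seed_bound k l x\<close>.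
  The summand \<open>l * k\<close> serves the rotation: with more attachment vertices than that, one
  of the \<open>l\<close> paths has more than \<open>k\<close>.\<close>

definition robustness :: "nat \<Rightarrow> nat \<Rightarrow> nat \<Rightarrow> nat" where
  "robustness k l x = seed_bound k l x + l * k"

text \<open>Size of the deleted set after \<open>j\<close> failures: each one adds a separator no
  larger than the robustness asked for at its stage.\<close>

fun deletion_bound :: "nat \<Rightarrow> nat \<Rightarrow> nat \<Rightarrow> nat" where
  "deletion_bound k l 0 = 0"
| "deletion_bound k l (Suc j) = deletion_bound k l j + robustness k l (deletion_bound k l j)"

text \<open>Set and paths are lists because these turn into tuples of quantified vertices;
  \<open>j\<close> is the stage at which the search for a robust set succeeds.\<close>

definition certified :: "nat \<Rightarrow> nat \<Rightarrow> 'a pair_pre_digraph \<Rightarrow> 'a list \<Rightarrow> 'a list \<Rightarrow> bool" where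
  "certified k l G s t \<longleftrightarrow> (\<exists>j<k. \<exists>X. length X \<le> deletion_bound k l j \<and> set X \<subseteq> pverts G \<and>
     robust G (set X) (robustness k l (deletion_bound k l j)) \<and>
     (\<exists>ps. length ps = l \<and>
        (\<forall>p\<in>set ps. length p \<le> seed_bound k l (deletion_bound k l j) \<and> set p \<subseteq> pverts G) \<and>
        linkage (adj G) (pverts G) l s t ((!) ps) \<and> seed G (set X) l ((!) ps)))"

section \<open>From spanning linkages to bounded seeds\<close>

context bounded_independence
begin

lemma thin_linkage:
  assumes "linkage (jump G X) (pverts G) l s t P" "seed G X l P"
  shows "\<exists>P'. linkage (jump G X) (pverts G) l s t P' \<and> seed G X l P' \<and>
    (\<forall>i<l. length (P' i) \<le> 3 * card X + 2)"
  using assms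
proof (induction "\<Sum>i<l. length (P i)" arbitrary: P rule: less_induct)
  case less
  have XV: "X \<subseteq> pverts G"
    using less.prems(2) linkage_covered_subset[OF less.prems(1)] by (auto simp: seed_def)
  show ?case
  proof (cases "\<exists>i<l. \<exists>a x y z b. P i = a @ [x, y, z] @ b \<and> x \<notin> X \<and> y \<notin> X \<and> z \<notin> X")
    case True
    then obtain i a x y z b where i: "i < l" "P i = a @ [x, y, z] @ b" and "x \<notin> X" "y \<notin> X" "z \<notin> X"
      by blast
    let ?q = "a @ [x, z] @ b" and ?P = "P(i := a @ [x, z] @ b)"
    have Pi: "distinct (P i)" "set (P i) \<subseteq> pverts G" "successively (jump G X) (P i)"
      using less.prems(1) i(1) by (auto simp: linkage_def)
    have xyz: "x \<in> pverts G - X" "y \<in> pverts G - X" "z \<in> pverts G - X"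
      using Pi(2) i(2) \<open>x \<notin> X\<close> \<open>y \<notin> X\<close> \<open>z \<notin> X\<close> by auto
    have "jump G X x y" "jump G X y z" using Pi(3) i(2) by (auto simp: successively_append_iff)
    then have joined: "joined G X x y" "joined G X y z" "joined G X x z"
    proof -
      show xy: "joined G X x y" and yz: "joined G X y z"
        using xyz joined_adj[of x y G X] joined_adj[of y z G X] \<open>jump G X x y\<close> \<open>jump G X y z\<close>
        unfolding jump_def by blast+
      show "joined G X x z" by (rule joined_trans[OF xy yz])
    qed
    have "linkage (jump G X) (pverts G) l s t ?P"
    proof (rule linkage_fun_upd[OF less.prems(1) i(1)])
      show "successively (jump G X) ?q"
        using Pi(3) i(2) joined(3) by (auto simp: successively_append_iff successively_Cons jump_def)
    next
      show "hd ?q = hd (P i)" using i(2) by (cases a) auto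
    qed (use Pi i(2) in auto)
    moreover have "seed G X l ?P"
      unfolding seed_def
    proof (intro conjI ballI)
      have cov: "covered l P - {y} \<subseteq> covered l ?P"
        using covered_fun_upd_lower[OF i(1), of P ?q] i(2) by auto
      then show "X \<subseteq> covered l ?P" using less.prems(2) \<open>y \<notin> X\<close> by (auto simp: seed_def)
      fix w assume w: "w \<in> pverts G - X"
      show "w \<in> covered l ?P \<or>
        (\<exists>i<l. enters G X w (?P i))"
      proof (cases "w \<in> covered l ?P")
        case False
        \<comment> \<open>A pair that used \<open>y\<close> is replaced by \<open>x, z\<close>; and
          if \<open>w\<close> is the vertex \<open>y\<close> that has just become uncovered,
          \<open>x, z\<close> is a pair in its component.\<close>
        have "enters G X w ?q"
          if "enters G X w (P i) \<or> w = y"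
          unfolding enters_def
        proof
          assume suc: "successively (\<lambda>u v. \<not> (joined G X w u \<and> joined G X w v)) ?q"
          have iff: "joined G X w x \<longleftrightarrow> joined G X w z" "joined G X w y \<longleftrightarrow> joined G X w x"
            using joined_cong(2)[OF joined(1)] joined_cong(2)[OF joined(3)] by blast+
          have "joined G X y z \<and> joined G X y x" using joined joined_sym by blast
          with suc iff that i(2) show False
            by (auto simp: enters_def successively_append_iff successively_Cons)
        qed
        moreover have "w = y \<or> (\<exists>i<l. enters G X w (P i))"
          using less.prems(2) w False cov unfolding seed_def by blast
        ultimately show ?thesis
          using i(1) ex_fun_upd[of l "enters G X w" P ?q i] by blast
      qed simp
    qed
    moreover have "(\<Sum>j<l. length (?P j)) < (\<Sum>j<l. length (P j))"
      using sum_fun_upd[OF i(1), of length P ?q] i(2) by simp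
    ultimately show ?thesis using less.hyps[of ?P] by blast
  next
    case False
    have "length (P i) \<le> 3 * card X + 2" if i: "i < l" for i
    proof -
      have "distinct (P i)" using less.prems(1) i by (auto simp: linkage_def)
      then have "length (filter (\<lambda>x. x \<in> X) (P i)) = card (set (filter (\<lambda>x. x \<in> X) (P i)))"
        by (metis distinct_card distinct_filter)
      also have "\<dots> \<le> card X"
        using XV pair_finite_verts by (intro card_mono) (auto intro: finite_subset)
      finally show ?thesis
        using length_le_if_triples_meet[of "P i" X] False i by fastforce
    qed
    then show ?thesis using less.prems by blast
  qed
qed

text \<open>Each detour adds at most \<open>2 * k\<close> vertices and uses up one jump, so the sum
  bounded by \<open>B\<close> never grows. The linkage thus always has at most \<open>c\<close>
  vertices, and robustness permits deleting all of them except the two ends of the jump.\<close>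

lemma realise_jumps:
  assumes X: "robust G X c"
    and "linkage (jump G X) (pverts G) l s t P" "seed G X l P"
    and "(\<Sum>i<l. length (P i)) + 2 * k * (\<Sum>i<l. njumps (adj G) (P i)) \<le> B" "B \<le> c"
  shows "\<exists>P'. linkage (adj G) (pverts G) l s t P' \<and> seed G X l P' \<and> (\<Sum>i<l. length (P' i)) \<le> B"
  using assms(2-)
proof (induction "\<Sum>i<l. njumps (adj G) (P i)" arbitrary: P)
  case 0
  then have "successively (adj G) (P i)" if "i < l" for i
    using that by (simp add: njumps_eq_0_iff)
  then have "linkage (adj G) (pverts G) l s t P"
    using linkage_coarsen[OF 0(2)] by blast
  then show ?case using 0 by auto
next
  case (Suc J)
  then have "\<not> (\<forall>i\<in>{..<l}. njumps (adj G) (P i) = 0)" by (metis Zero_not_Suc sum.neutral)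
  then obtain i where i: "i < l" "njumps (adj G) (P i) \<noteq> 0" by blast
  then have "\<not> successively (adj G) (P i)" by (simp add: njumps_eq_0_iff)
  then obtain a x y b where p: "P i = a @ [x, y] @ b" "\<not> adj G x y"
    unfolding not_successively_iff by blast
  have Pi: "distinct (P i)" "set (P i) \<subseteq> pverts G" "successively (jump G X) (P i)"
    using Suc.prems(1) i(1) by (auto simp: linkage_def)
  have xy: "joined G X x y" "x \<noteq> y"
    using Pi p by (auto simp: successively_append_iff jump_def)
  let ?S = "covered l P - {x, y}"
  have "card ?S \<le> card (covered l P)" by (rule card_mono) (auto simp: finite_covered)
  also have "\<dots> \<le> c" using card_covered_le[of l P] Suc.prems(3,4) by linarith
  finally have "card ?S \<le> c" .
  moreover have "?S \<subseteq> pverts G" using Suc.prems(1) by (auto simp: covered_def linkage_def)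
  ultimately have "joined G (X \<union> ?S) x y" using X xy(1) unfolding robust_def by blast
  then obtain q where q: "walk_avoiding G (X \<union> ?S) q" "hd q = x" "last q = y" "distinct q"
    "length q \<le> 2 * k" using joined_short by metis
  obtain m where m: "q = x # m @ [y]"
  proof -
    obtain r where "q = x # r" using q by (cases q) (auto simp: walk_avoiding_def)
    moreover from this have "r \<noteq> []" using q xy(2) by auto
    ultimately show ?thesis using that[of "butlast r"] q by (metis append_butlast_last_id last_ConsR)
  qed
  have qW: "set q \<inter> (covered l P) \<subseteq> {x, y}" "set q \<subseteq> pverts G - X" "successively (adj G) q"
    using q(1) by (auto simp: walk_avoiding_def)
  have "walk_avoiding G X q" using q(1) by (auto simp: walk_avoiding_def)
  from joined_hd[OF this] have jx: "\<And>z. z \<in> set q \<Longrightarrow> joined G X x z" using q(2) by blast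
  let ?q = "a @ q @ b" and ?P = "P(i := a @ q @ b)"
  have Pcov: "set (P i) \<subseteq> covered l P" using i(1) by (auto simp: covered_def)
  have set_q: "set ?q = set (P i) \<union> set q" using p m by auto
  have l1: "linkage (jump G X) (pverts G) l s t ?P"
  proof (rule linkage_fun_upd[OF Suc.prems(1) i(1)])
    show "distinct ?q" using Pi(1) Pcov q(4) qW(1) p(1) m by auto
    have "successively (jump G X) q" using qW(3) by (rule successively_mono) (simp add: jump_def)
    then show "successively (jump G X) ?q"
      using Pi(3) p(1) m by (cases m) (auto simp: successively_append_iff successively_Cons hd_append)
    show "hd ?q = hd (P i)" using p m by (cases a) auto
    show "last ?q = last (P i)" using p m by auto
    show "set ?q \<inter> (covered l P - set (P i)) = {}" using set_q qW(1) p(1) by auto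
  qed (use set_q Pi(2) qW(2) m in auto)
  have l2: "seed G X l ?P"
    unfolding seed_def
  proof (intro conjI ballI)
    have cov: "covered l P \<subseteq> covered l ?P"
      using covered_fun_upd_superset[of i l P ?q] i(1) set_q by auto
    then show "X \<subseteq> covered l ?P" using Suc.prems(2) by (auto simp: seed_def)
    fix w assume w: "w \<in> pverts G - X"
    have "enters G X w ?q"
      if "enters G X w (P i)"
      unfolding enters_def
    proof
      assume suc: "successively (\<lambda>u v. \<not> (joined G X w u \<and> joined G X w v)) ?q"
      \<comment> \<open>Only the pair \<open>x, y\<close> is lost. If \<open>x\<close> were in the
        component of \<open>w\<close>, so would be the next vertex of \<open>q\<close>, since
        \<open>q\<close> avoids \<open>X\<close>.\<close>
      have "\<not> joined G X w x"
        using suc m jx[of "hd (m @ [y])"] joined_trans[of G X w x "hd (m @ [y])"]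
        by (cases m) (auto simp: successively_append_iff successively_Cons hd_append)
      then show False using that suc p(1) m
        by (auto simp: enters_def successively_append_iff successively_Cons)
    qed
    moreover have "w \<in> covered l P \<or>
        (\<exists>i<l. enters G X w (P i))"
      using Suc.prems(2) w unfolding seed_def by blast
    ultimately show "w \<in> covered l ?P \<or>
        (\<exists>i<l. enters G X w (?P i))"
      using cov i(1) ex_fun_upd[of l "enters G X w" P ?q i] by blast
  qed
  have "njumps (adj G) (P i) = Suc (njumps (adj G) ?q)"
  proof -
    have "njumps (adj G) (P i) = njumps (adj G) (a @ [x]) + 1 + njumps (adj G) (y # b)"
      using p njumps_append[of "adj G" a x "y # b"] by simp
    moreover have "njumps (adj G) ?q = njumps (adj G) (a @ [x]) + njumps (adj G) ((x # m) @ y # b)"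
      using m njumps_append[of "adj G" a x "m @ y # b"] by simp
    moreover have "njumps (adj G) ((x # m) @ y # b) = njumps (adj G) q + njumps (adj G) (y # b)"
      using m njumps_append[of "adj G" "x # m" y b] by simp
    moreover have "njumps (adj G) q = 0" using qW(3) by (simp add: njumps_eq_0_iff)
    ultimately show ?thesis by simp
  qed
  then have nj: "(\<Sum>j<l. njumps (adj G) (P j)) = Suc (\<Sum>j<l. njumps (adj G) (?P j))"
    using sum_fun_upd[OF i(1), of "njumps (adj G)" P ?q] by simp
  have "length ?q \<le> length (P i) + 2 * k" using p(1) q(5) by simp
  then have "(\<Sum>j<l. length (?P j)) \<le> (\<Sum>j<l. length (P j)) + 2 * k"
    using sum_fun_upd[OF i(1), of length P ?q] by linarith
  then have "(\<Sum>j<l. length (?P j)) + 2 * k * (\<Sum>j<l. njumps (adj G) (?P j)) \<le> B"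
    using Suc.prems(3) unfolding nj by (simp add: algebra_simps)
  then show ?case using Suc.hyps(1)[OF _ l1 l2 _ Suc.prems(4)] Suc.hyps(2) nj by simp
qed

text \<open>A spanning linkage is a seed because it covers everything; thinning makes its length
  independent of \<open>G\<close>, and the jumps created thereby are realised.\<close>

lemma seed_if_spanning:
  assumes "spanning_linkage l G s t P" "robust G X c" "seed_bound k l (card X) \<le> c"
  shows "\<exists>P'. linkage (adj G) (pverts G) l s t P' \<and> seed G X l P' \<and>
    (\<Sum>i<l. length (P' i)) \<le> seed_bound k l (card X)"
proof -
  have P: "linkage (adj G) (pverts G) l s t P" "covered l P = pverts G"
    using assms(1) by (auto simp: spanning_linkage_iff)
  have "successively (jump G X) (P i)" if "i < l" for i
    using P(1) that unfolding linkage_def by (meson jump_def successively_mono)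
  then have "linkage (jump G X) (pverts G) l s t P"
    using linkage_coarsen[OF P(1)] by blast
  moreover have "seed G X l P" using P(2) assms(2) by (auto simp: seed_def robust_def)
  ultimately obtain P1 where P1: "linkage (jump G X) (pverts G) l s t P1" "seed G X l P1"
    "\<forall>i<l. length (P1 i) \<le> 3 * card X + 2" using thin_linkage by blast
  have len: "(\<Sum>i<l. length (P1 i)) \<le> l * (3 * card X + 2)"
    using sum_bounded_above[of "{..<l}" "\<lambda>i. length (P1 i)" "3 * card X + 2"] P1(3) by simp
  \<comment> \<open>At most one jump per vertex: the origin of the factor \<open>2 * k + 1\<close>
    in \<open>seed_bound\<close>.\<close>
  have "(\<Sum>i<l. njumps (adj G) (P1 i)) \<le> (\<Sum>i<l. length (P1 i))"
    by (intro sum_mono njumps_le_length)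
  then have "(\<Sum>i<l. njumps (adj G) (P1 i)) \<le> l * (3 * card X + 2)" using len by linarith
  then have "2 * k * (\<Sum>i<l. njumps (adj G) (P1 i)) \<le> 2 * k * (l * (3 * card X + 2))"
    by (rule mult_left_mono) simp
  then have "(\<Sum>i<l. length (P1 i)) + 2 * k * (\<Sum>i<l. njumps (adj G) (P1 i)) \<le> seed_bound k l (card X)"
    using len by (simp add: seed_bound_def algebra_simps)
  from realise_jumps[OF assms(2) P1(1,2) this assms(3)] show ?thesis .
qed

section \<open>Existence of robust sets\<close>

text \<open>
  Each time \<open>X\<close> fails to be robust, it is enlarged by a separator of one component of \<open>G - X\<close>,
  which increases the number of components; representatives of the components are independent.
\<close>

lemma robust_or_many_components:
  assumes "\<And>j. b (Suc j) = b j + c j"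
  shows "(\<exists>j'<j. \<exists>X. robust G X (c j') \<and> card X \<le> b j') \<or>
    (\<exists>X I. X \<subseteq> pverts G \<and> card X \<le> b j \<and> I \<subseteq> pverts G - X \<and> j \<le> card I \<and>
       (\<forall>u\<in>I. \<forall>v\<in>I. joined G X u v \<longrightarrow> u = v))"
proof (induction j)
  case 0
  then show ?case by (intro disjI2 exI[of _ "{}"]) simp
next
  case (Suc j)
  then consider "\<exists>j'<j. \<exists>X. robust G X (c j') \<and> card X \<le> b j'"
    | X I where "X \<subseteq> pverts G" "card X \<le> b j" "I \<subseteq> pverts G - X" "j \<le> card I"
      "\<forall>u\<in>I. \<forall>v\<in>I. joined G X u v \<longrightarrow> u = v" by blast
  then show ?case
  proof cases
    case 1
    then show ?thesis using less_SucI by blast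
  next
    case (2 X I)
    show ?thesis
    proof (cases "robust G X (c j)")
      case True
      then show ?thesis using 2(2) by blast
    next
      case False
      then obtain S u v where S: "S \<subseteq> pverts G" "card S \<le> c j" "u \<notin> S" "v \<notin> S" "joined G X u v"
        "\<not> joined G (X \<union> S) u v" using 2(1) unfolding robust_def by blast
      \<comment> \<open>Cutting only inside the component of \<open>u\<close> keeps the
        representatives of all other components. Its own representative, if any, gives way to
        \<open>u\<close> and \<open>v\<close>, a gain of at least one.\<close>
      define S' where "S' = S \<inter> Collect (joined G X u)"
      define I' where "I' = insert u (insert v {z \<in> I. \<not> joined G X u z})"
      have uv: "u \<in> pverts G - X" "v \<in> pverts G - X" using joinedD[OF S(5)] by auto
      \<comment> \<open>A walk from \<open>u\<close> avoiding \<open>X\<close> stays in the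
        component of \<open>u\<close>, where \<open>S\<close> and \<open>S'\<close> agree.\<close>
      have sep: "\<not> joined G (X \<union> S') u v"
      proof
        assume "joined G (X \<union> S') u v"
        then obtain p where p: "walk_avoiding G (X \<union> S') p" "hd p = u" "last p = v"
          by (auto simp: joined_def)
        then have "walk_avoiding G X p" by (auto simp: walk_avoiding_def)
        from joined_hd[OF this] have "set p \<inter> S = {}"
          using p(1,2) by (auto simp: S'_def walk_avoiding_def)
        then have "walk_avoiding G (X \<union> S) p" using p(1) by (auto simp: walk_avoiding_def)
        then show False using S(6) p unfolding joined_def by blast
      qed
      have fin: "finite I" using 2(3) pair_finite_verts by (meson Diff_subset finite_subset)
      have "card {z \<in> I. joined G X u z} \<le> 1"
      proof (rule card_le_Suc0_iff_eq[THEN iffD2, unfolded One_nat_def[symmetric]])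
        show "\<forall>a\<in>{z \<in> I. joined G X u z}. \<forall>b\<in>{z \<in> I. joined G X u z}. a = b"
          using 2(5) joined_cong(1) by blast
      qed (use fin in simp)
      moreover have "card I = card {z \<in> I. joined G X u z} + card {z \<in> I. \<not> joined G X u z}"
        using fin by (subst card_Un_disjoint[symmetric]) (auto intro: arg_cong[of _ _ card])
      moreover have "card I' = Suc (Suc (card {z \<in> I. \<not> joined G X u z}))"
      proof -
        have "u \<noteq> v" using sep uv S(3) joined_refl[of u G "X \<union> S'"] by (auto simp: S'_def)
        then show ?thesis using fin S(5) joined_refl[OF uv(1)] unfolding I'_def by simp
      qed
      ultimately have "Suc j \<le> card I'" using 2(4) by simp
      moreover have "I' \<subseteq> pverts G - (X \<union> S')"
        using 2(3) uv S(3,4) by (auto simp: I'_def S'_def)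
      moreover have "X \<union> S' \<subseteq> pverts G" using 2(1) S(1) by (auto simp: S'_def)
      moreover have "card (X \<union> S') \<le> b (Suc j)"
      proof -
        have "card S' \<le> card S"
          using S(1) pair_finite_verts by (intro card_mono) (auto simp: S'_def intro: finite_subset)
        then show ?thesis using card_Un_le[of X S'] 2(2) S(2) assms[of j] by linarith
      qed
      moreover have "\<forall>x\<in>I'. \<forall>y\<in>I'. joined G (X \<union> S') x y \<longrightarrow> x = y"
      proof (intro ballI impI)
        fix x y assume xy: "x \<in> I'" "y \<in> I'" "joined G (X \<union> S') x y"
        then have j: "joined G X x y" "joined G X y x" by (auto intro: joined_mono joined_sym)
        have "\<not> joined G (X \<union> S') v u" using sep joined_sym by blast
        moreover have "joined G X u z \<longleftrightarrow> joined G X v z" for z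
          by (rule joined_cong(1)[OF S(5)])
        ultimately show "x = y"
          using xy sep j 2(5) joined_refl[OF uv(1)] joined_refl[OF uv(2)] S(5)
          unfolding I'_def by (auto dest: joined_sym)
      qed
      ultimately show ?thesis by blast
    qed
  qed
qed

lemma robust_exists:
  assumes "\<And>j. b (Suc j) = b j + c j"
  shows "\<exists>j<k. \<exists>X. robust G X (c j) \<and> card X \<le> b j"
proof (rule ccontr)
  assume "\<not> ?thesis"
  then obtain X I where X: "X \<subseteq> pverts G" "I \<subseteq> pverts G - X" "k \<le> card I"
    "\<forall>u\<in>I. \<forall>v\<in>I. joined G X u v \<longrightarrow> u = v"
    using robust_or_many_components[of b c k] assms by blast
  have "independent_set G I"
    unfolding independent_set_def
  proof (intro conjI ballI notI)
    fix u v assume "u \<in> I" "v \<in> I" "adj G u v"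
    then show False using X joined_adj[of u v G X] adj_irrefl by blast
  qed (use X in auto)
  then show False using indep X(3) by fastforce
qed

text \<open>Any sufficiently robust set is good enough for soundness, so the certificate may guess
  one. For completeness, monotonicity of \<open>seed_bound\<close> passes from \<open>card X\<close>
  to the bound of the stage.\<close>

lemma spanning_linkage_iff_certified: "(\<exists>P. spanning_linkage l G s t P) \<longleftrightarrow> certified k l G s t"
proof
  assume "certified k l G s t"
  then obtain j X ps where *: "robust G (set X) (robustness k l (deletion_bound k l j))"
    "linkage (adj G) (pverts G) l s t ((!) ps)" "seed G (set X) l ((!) ps)"
    unfolding certified_def by blast
  show "\<exists>P. spanning_linkage l G s t P"
    by (rule seed_saturate[OF *(2,3,1)]) (simp add: robustness_def)
next
  assume "\<exists>P. spanning_linkage l G s t P"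
  then obtain P where P: "spanning_linkage l G s t P" by blast
  obtain j X where j: "j < k" and X: "robust G X (robustness k l (deletion_bound k l j))"
    "card X \<le> deletion_bound k l j"
    using robust_exists[of "deletion_bound k l" "\<lambda>j. robustness k l (deletion_bound k l j)"] by auto
  have XV: "X \<subseteq> pverts G" using X(1) by (simp add: robust_def)
  then obtain X' where X': "set X' = X" "length X' = card X"
    using pair_finite_verts finite_distinct_list[of X] distinct_card by (metis finite_subset)
  have le: "seed_bound k l (card X) \<le> seed_bound k l (deletion_bound k l j)"
    unfolding seed_bound_def by (intro mult_left_mono) (use X(2) in auto)
  then have "seed_bound k l (card X) \<le> robustness k l (deletion_bound k l j)"
    by (simp add: robustness_def)
  from seed_if_spanning[OF P X(1) this] obtain Q where Q: "linkage (adj G) (pverts G) l s t Q"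
    "seed G X l Q" "(\<Sum>i<l. length (Q i)) \<le> seed_bound k l (card X)" by blast
  let ?ps = "map Q [0..<l]"
  have eq: "?ps ! i = Q i" if "i < l" for i using that by simp
  have "length (Q i) \<le> seed_bound k l (deletion_bound k l j)" if "i < l" for i
    using member_le_sum[of i "{..<l}" "\<lambda>i. length (Q i)"] that Q(3) le by simp
  moreover have "set (Q i) \<subseteq> pverts G" if "i < l" for i using Q(1) that by (simp add: linkage_def)
  ultimately have "\<forall>p\<in>set ?ps. length p \<le> seed_bound k l (deletion_bound k l j) \<and> set p \<subseteq> pverts G"
    by auto
  moreover have "linkage (adj G) (pverts G) l s t ((!) ?ps)"
    using Q(1) unfolding linkage_def by (simp add: eq)
  moreover have "covered l ((!) ?ps) = covered l Q" by (simp add: covered_def)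
  then have "seed G X l ((!) ?ps)" using Q(2) unfolding seed_def by (auto simp: eq)
  moreover have "length ?ps = l" by simp
  ultimately have "\<exists>ps. length ps = l \<and>
      (\<forall>p\<in>set ps. length p \<le> seed_bound k l (deletion_bound k l j) \<and> set p \<subseteq> pverts G) \<and>
      linkage (adj G) (pverts G) l s t ((!) ps) \<and> seed G X l ((!) ps)" by blast
  then show "certified k l G s t"
    unfolding certified_def using j X XV X' by (intro exI[of _ j] conjI exI[of _ X']) auto
qed

section \<open>Connectivity and robustness in terms of bounded lists\<close>

lemma joined_iff_short:
  "joined G X u v \<longleftrightarrow> (\<exists>p. length p \<le> 2 * k \<and> set p \<subseteq> pverts G \<and> (\<forall>x\<in>set p. \<not> x \<in> X) \<and>
     successively (adj G) p \<and> (p \<noteq> [] \<and> hd p = u) \<and> (p \<noteq> [] \<and> last p = v))"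
proof
  assume "joined G X u v"
  then obtain p where "walk_avoiding G X p" "hd p = u" "last p = v" "length p \<le> 2 * k"
    using joined_short by metis
  then show "\<exists>p. length p \<le> 2 * k \<and> set p \<subseteq> pverts G \<and> (\<forall>x\<in>set p. \<not> x \<in> X) \<and>
     successively (adj G) p \<and> (p \<noteq> [] \<and> hd p = u) \<and> (p \<noteq> [] \<and> last p = v)"
    unfolding walk_avoiding_def by (intro exI[of _ p]) auto
qed (auto simp: joined_def walk_avoiding_def)

text \<open>Negated existentials over lists are what the decision procedure handles; repetitions in
  \<open>S\<close> are harmless since the cardinality of a list's set is at most its length.\<close>

lemma robust_iff_lists:
  assumes "X \<subseteq> pverts G"
  shows "robust G X c \<longleftrightarrow> \<not> (\<exists>S. length S \<le> c \<and> set S \<subseteq> pverts G \<and> (\<exists>u\<in>pverts G. \<exists>v\<in>pverts G.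
    \<not> u \<in> set S \<and> \<not> v \<in> set S \<and> joined G X u v \<and> \<not> joined G (X \<union> set S) u v))"
proof
  assume "robust G X c"
  then show "\<not> (\<exists>S. length S \<le> c \<and> set S \<subseteq> pverts G \<and> (\<exists>u\<in>pverts G. \<exists>v\<in>pverts G.
    \<not> u \<in> set S \<and> \<not> v \<in> set S \<and> joined G X u v \<and> \<not> joined G (X \<union> set S) u v))"
    unfolding robust_def by (meson card_length order_trans)
next
  assume *: "\<not> (\<exists>S. length S \<le> c \<and> set S \<subseteq> pverts G \<and> (\<exists>u\<in>pverts G. \<exists>v\<in>pverts G.
    \<not> u \<in> set S \<and> \<not> v \<in> set S \<and> joined G X u v \<and> \<not> joined G (X \<union> set S) u v))"
  show "robust G X c"
    unfolding robust_def
  proof (intro conjI allI impI)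
    fix S u v assume S: "S \<subseteq> pverts G" "card S \<le> c" "u \<notin> S" "v \<notin> S" "joined G X u v"
    obtain S' where S': "set S' = S" "length S' = card S"
      using S(1) pair_finite_verts finite_distinct_list[of S] distinct_card by (metis finite_subset)
    have "length S' \<le> c" "set S' \<subseteq> pverts G" "u \<in> pverts G" "v \<in> pverts G" "u \<notin> set S'" "v \<notin> set S'"
      using S S' joinedD[OF S(5)] by auto
    with * S(5) have "joined G (X \<union> set S') u v" by blast
    then show "joined G (X \<union> S) u v" by (simp only: S'(1))
  qed fact
qed

end

lemma bounded_independence_if_independence_number_less:
  assumes "pair_graph G" "independence_number G < k"
  shows "bounded_independence G k"
proof -
  interpret pair_graph G by fact
  have "finite {S. independent_set G S}"
    using pair_finite_verts by (auto intro: finite_subset[of _ "Pow (pverts G)"] simp: independent_set_def)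
  then have "card I \<le> independence_number G" if "independent_set G I" for I
    unfolding independence_number_def using that by (intro Max_ge) auto
  then show ?thesis using assms(2) by unfold_locales (meson le_less_trans)
qed


section \<open>Deciding first-order properties on a random access machine\<close>

lemma length_concat_const: "(\<And>x. x \<in> set xs \<Longrightarrow> length (f x) = m) \<Longrightarrow> length (concat (map f xs)) = length xs * m"
  by (induction xs) auto

lemma nth_concat_rows:
  assumes "i < a" "j < b"
  shows "concat (map (\<lambda>i. map (f i) [0..<b]) [0..<a]) ! (i * b + j) = f i j"
  using assms(1)
proof (induction a)
  case 0
  then show ?case by simp
next
  case (Suc a)
  let ?r = "concat (map (\<lambda>i. map (f i) [0..<b]) [0..<a])"
  have len: "length ?r = a * b" by (subst length_concat_const[where m=b]) auto
  show ?case
  proof (cases "i < a")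
    case True
    then have "(i + 1) * b \<le> a * b" by (intro mult_right_mono) auto
    then have "i * b + j < a * b" using assms(2) by simp
    then show ?thesis using Suc.IH True len by (simp add: nth_append)
  next
    case False
    then have "i = a" using Suc.prems by simp
    then show ?thesis using assms(2) len by (simp add: nth_append)
  qed
qed

definition nverts :: "nat pair_pre_digraph \<Rightarrow> nat" where
  "nverts G = card (pverts G)"

lemma input_graphs_pverts: "G \<in> input_graphs \<Longrightarrow> pverts G = {..<nverts G}"
  unfolding input_graphs_def nverts_def by clarsimp

lemma length_encode_graph: "length (encode_graph G) = nverts G + 1 + nverts G * nverts G"
  unfolding encode_graph_def nverts_def Let_def
  by (simp del: length_concat add: length_concat_const[where m="card (pverts G)"])

lemma input_symbol_edge:
  assumes "i < nverts G" "j < nverts G"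
  shows "input_symbol (encode_graph G) (nverts G + 1 + i * nverts G + j) =
    (if (i, j) \<in> parcs G then 2 else 1)"
proof -
  let ?n = "nverts G"
  have "(i + 1) * ?n \<le> ?n * ?n" using assms by (intro mult_right_mono) auto
  then have lt: "?n + 1 + i * ?n + j < length (encode_graph G)"
    using assms by (simp add: length_encode_graph)
  have "encode_graph G ! (?n + 1 + i * ?n + j) =
    concat (map (\<lambda>i. map (\<lambda>j. (i, j) \<in> parcs G) [0..<?n]) [0..<?n]) ! (i * ?n + j)"
    unfolding encode_graph_def nverts_def Let_def by (simp add: nth_append)
  also have "\<dots> \<longleftrightarrow> (i, j) \<in> parcs G"
    by (rule nth_concat_rows[OF assms])
  finally show ?thesis using lt by (simp add: input_symbol_def)
qed

lemma input_symbol_unary: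
  assumes "i \<le> nverts G"
  shows "input_symbol (encode_graph G) i = (if i < nverts G then 2 else 1)"
proof -
  have "encode_graph G ! i \<longleftrightarrow> i < nverts G"
    using assms by (cases "i < nverts G") (auto simp: encode_graph_def nverts_def Let_def nth_append)
  then show ?thesis using assms by (simp add: input_symbol_def length_encode_graph)
qed

section \<open>Execution of code fragments\<close>

definition code_at :: "program \<Rightarrow> nat \<Rightarrow> program \<Rightarrow> bool" where
  "code_at prog a c \<longleftrightarrow> a + length c \<le> length prog \<and> (\<forall>i<length c. prog ! (a + i) = c ! i)"

lemma code_at_append: "code_at prog a (c @ c') \<longleftrightarrow> code_at prog a c \<and> code_at prog (a + length c) c'"
proof
  assume *: "code_at prog a (c @ c')"
  have "prog ! (a + i) = c ! i" if "i < length c" for i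
    using * that unfolding code_at_def by (metis length_append nth_append trans_less_add1)
  moreover have "prog ! (a + length c + i) = c' ! i" if "i < length c'" for i
    using * that unfolding code_at_def
    by (metis add.assoc length_append nat_add_left_cancel_less nth_append_length_plus)
  ultimately show "code_at prog a c \<and> code_at prog (a + length c) c'"
    using * unfolding code_at_def by auto
next
  assume *: "code_at prog a c \<and> code_at prog (a + length c) c'"
  have "prog ! (a + i) = (c @ c') ! i" if "i < length (c @ c')" for i
  proof (cases "i < length c")
    case True
    then show ?thesis using * by (auto simp: code_at_def nth_append)
  next
    case False
    then obtain j where "i = length c + j" using le_Suc_ex not_less by blast
    then show ?thesis using * that by (auto simp: code_at_def nth_append add.assoc)
  qed
  then show "code_at prog a (c @ c')"
    using * unfolding code_at_def by auto
qed

lemma code_at_Nil: "code_at prog a [] \<longleftrightarrow> a \<le> length prog"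
  by (simp add: code_at_def)

lemma code_at_Cons: "code_at prog a (x # c) \<longleftrightarrow> a < length prog \<and> prog ! a = x \<and> code_at prog (Suc a) c"
  using code_at_append[of prog a "[x]" c] by (auto simp: code_at_def)

definition reaches :: "program \<Rightarrow> bool list \<Rightarrow> nat \<Rightarrow> config \<Rightarrow> config \<Rightarrow> bool" where
  "reaches prog w T c c' \<longleftrightarrow> (\<exists>t\<le>T. (step prog w ^^ t) c = c')"

lemma reaches_refl: "reaches prog w T c c"
  unfolding reaches_def by (rule exI[of _ 0]) simp

lemma reaches_trans:
  assumes "reaches prog w T c c'" "reaches prog w T' c' c''" "T + T' \<le> U"
  shows "reaches prog w U c c''"
proof -
  obtain t t' where "t \<le> T" "t' \<le> T'" "(step prog w ^^ t) c = c'" "(step prog w ^^ t') c' = c''"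
    using assms by (auto simp: reaches_def)
  then have "(step prog w ^^ (t' + t)) c = c''" by (simp add: funpow_add)
  moreover have "t' + t \<le> U" using \<open>t \<le> T\<close> \<open>t' \<le> T'\<close> assms(3) by simp
  ultimately show ?thesis unfolding reaches_def by blast
qed

lemma reaches_step:
  assumes "pc < length prog" "reaches prog w T (exec w (prog ! pc) (pc, M)) c" "Suc T \<le> U"
  shows "reaches prog w U (pc, M) c"
proof (rule reaches_trans[OF _ assms(2), of 1])
  show "reaches prog w 1 (pc, M) (exec w (prog ! pc) (pc, M))"
    unfolding reaches_def
    by (rule exI[of _ 1]) (use assms(1) in \<open>simp add: step_def halted_def\<close>)
qed (use assms(3) in simp)

lemma reaches_mono: "reaches prog w T c c' \<Longrightarrow> T \<le> U \<Longrightarrow> reaches prog w U c c'"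
  using reaches_trans[OF _ reaches_refl[of _ _ 0]] by simp

text \<open>With exact step counts, \<open>reaches_0\<close> and \<open>reaches_Suc\<close> let the
  simplifier execute code symbolically once numerals are unfolded.\<close>

lemma reaches_0: "reaches prog w 0 c c' \<longleftrightarrow> c = c'"
  by (simp add: reaches_def)

lemma reaches_Suc:
  "pc < length prog \<Longrightarrow> reaches prog w T (exec w (prog ! pc) (pc, M)) c \<Longrightarrow>
   reaches prog w (Suc T) (pc, M) c"
  by (rule reaches_step) auto

text \<open>
  Register \<open>0\<close> receives results, registers \<open>1\<close>, \<open>2\<close>, \<open>3\<close> hold \<open>1\<close>, the order \<open>n\<close> and \<open>n + 1\<close>,
  register \<open>4\<close> is scratch space. The \<open>i\<close>-th variable \<open>x\<close> is stored in register \<open>5 + 2 i\<close>, next to the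
  position in the input where row \<open>x\<close> of the adjacency matrix starts, so that no multiplication is
  needed to look up an edge.
\<close>

definition represents :: "nat pair_pre_digraph \<Rightarrow> nat list \<Rightarrow> (nat \<Rightarrow> nat) \<Rightarrow> bool" where
  "represents G xs M \<longleftrightarrow> M 1 = 1 \<and> M 2 = nverts G \<and> M 3 = nverts G + 1 \<and>
     (\<forall>i<length xs. M (5 + 2 * i) = xs ! i \<and> M (6 + 2 * i) = nverts G + 1 + xs ! i * nverts G)"

lemma represents_cong:
  assumes "represents G xs M" "\<And>r. 1 \<le> r \<Longrightarrow> r < 5 + 2 * length xs \<Longrightarrow> r \<noteq> 4 \<Longrightarrow> M' r = M r"
  shows "represents G xs M'"
  using assms unfolding represents_def by auto

lemma poly_nat_mono: "m \<le> n \<Longrightarrow> poly (p :: nat poly) m \<le> poly p n"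
  by (induction p) (auto intro!: add_mono mult_mono)

section \<open>Code for atoms, connectives and quantifiers\<close>

locale graph_class =
  fixes C :: "nat pair_pre_digraph set"
  assumes input: "C \<subseteq> input_graphs"
begin

lemma pverts_class: "G \<in> C \<Longrightarrow> pverts G = {..<nverts G}"
  using input input_graphs_pverts by blast

text \<open>Registers from \<open>5 + 2 * d\<close> on are left unconstrained: quantifiers inside
  the fragment keep their loop variables there.\<close>

definition fragment_decides ::
  "nat \<Rightarrow> (nat pair_pre_digraph \<Rightarrow> nat list \<Rightarrow> bool) \<Rightarrow> nat \<Rightarrow> program \<Rightarrow> nat poly \<Rightarrow> bool" where
  "fragment_decides d P a c p \<longleftrightarrow>
     (\<forall>G xs prog M. G \<in> C \<longrightarrow> length xs = d \<longrightarrow> set xs \<subseteq> pverts G \<longrightarrow>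
        code_at prog a c \<longrightarrow> represents G xs M \<longrightarrow>
        (\<exists>M'. reaches prog (encode_graph G) (poly p (nverts G)) (a, M) (a + length c, M') \<and>
              (M' 0 \<noteq> 0 \<longleftrightarrow> P G xs) \<and> (\<forall>r. 1 \<le> r \<and> r < 5 + 2 * d \<and> r \<noteq> 4 \<longrightarrow> M' r = M r)))"

text \<open>Jump targets are absolute, so the code depends on its position \<open>a\<close>. Its
  length does not, which lets enclosing fragments compute their own targets.\<close>

definition decidable :: "nat \<Rightarrow> (nat pair_pre_digraph \<Rightarrow> nat list \<Rightarrow> bool) \<Rightarrow> bool" where
  "decidable d P \<longleftrightarrow> (\<exists>c len p. \<forall>a. length (c a) = len \<and> fragment_decides d P a (c a) p)"

lemma fragment_decidesD:
  assumes "fragment_decides d P a c p" "G \<in> C" "length xs = d" "set xs \<subseteq> pverts G"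
    "code_at prog a c" "represents G xs M"
  obtains M' where "reaches prog (encode_graph G) (poly p (nverts G)) (a, M) (a + length c, M')"
    "M' 0 \<noteq> 0 \<longleftrightarrow> P G xs" "\<And>r. 1 \<le> r \<Longrightarrow> r < 5 + 2 * d \<Longrightarrow> r \<noteq> 4 \<Longrightarrow> M' r = M r"
proof -
  from assms have "\<exists>M'. reaches prog (encode_graph G) (poly p (nverts G)) (a, M) (a + length c, M') \<and>
    (M' 0 \<noteq> 0 \<longleftrightarrow> P G xs) \<and> (\<forall>r. 1 \<le> r \<and> r < 5 + 2 * d \<and> r \<noteq> 4 \<longrightarrow> M' r = M r)"
    unfolding fragment_decides_def by blast
  then show ?thesis using that by blast
qed

lemma decidable_cong:
  assumes "decidable d P"
    and "\<And>G xs. G \<in> C \<Longrightarrow> length xs = d \<Longrightarrow> set xs \<subseteq> pverts G \<Longrightarrow> P G xs \<longleftrightarrow> Q G xs"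
  shows "decidable d Q"
proof -
  have "fragment_decides d P a c p \<Longrightarrow> fragment_decides d Q a c p" for a c p
    unfolding fragment_decides_def using assms(2) by (smt (verit))
  then show ?thesis using assms(1) unfolding decidable_def by meson
qed


lemma decidableI:
  assumes "\<And>a. length (c a) = len"
    and "\<And>a G xs prog M. G \<in> C \<Longrightarrow> length xs = d \<Longrightarrow> set xs \<subseteq> pverts G \<Longrightarrow>
        code_at prog a (c a) \<Longrightarrow> represents G xs M \<Longrightarrow>
        \<exists>M'. reaches prog (encode_graph G) (poly p (nverts G)) (a, M) (a + len, M') \<and>
              (M' 0 \<noteq> 0 \<longleftrightarrow> P G xs) \<and> (\<forall>r. 1 \<le> r \<and> r < 5 + 2 * d \<and> r \<noteq> 4 \<longrightarrow> M' r = M r)"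
  shows "decidable d P"
  unfolding decidable_def fragment_decides_def
  by (rule exI[of _ c], rule exI[of _ len], rule exI[of _ p]) (use assms in simp)

text \<open>Row start plus column is the input position; \<open>Read\<close> yields \<open>2\<close>
  or \<open>1\<close> there, hence the final subtraction.\<close>

lemma decidable_adj:
  assumes "i < d" "j < d"
  shows "decidable d (\<lambda>G xs. (xs ! i, xs ! j) \<in> parcs G)"
proof (rule decidableI[where c="\<lambda>_. [Add 0 (6 + 2 * i) (5 + 2 * j), Read 0 0, Sub 0 0 1]" and p="[:3:]"])
  fix a G xs prog M
  assume A: "G \<in> C" "length xs = d" "set xs \<subseteq> pverts G"
    "code_at prog a [Add 0 (6 + 2 * i) (5 + 2 * j), Read 0 0, Sub 0 0 1]" "represents G xs M"
  have "xs ! i < nverts G" "xs ! j < nverts G"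
    using A assms pverts_class[OF A(1)] nth_mem by fastforce+
  note sym = input_symbol_edge[OF this]
  have M: "M (6 + 2 * i) = nverts G + 1 + xs ! i * nverts G" "M (5 + 2 * j) = xs ! j" "M 1 = 1"
    using A assms by (auto simp: represents_def)
  define M' where "M' = M(0 := if (xs ! i, xs ! j) \<in> parcs G then 1 else 0)"
  have "reaches prog (encode_graph G) 3 (a, M) (a + 3, M')"
    using A(4) M sym unfolding code_at_Cons
    by (simp add: numeral_3_eq_3 reaches_Suc reaches_0 M'_def)
  then show "\<exists>M'. reaches prog (encode_graph G) (poly [:3:] (nverts G)) (a, M) (a + 3, M') \<and>
        (M' 0 \<noteq> 0 \<longleftrightarrow> (xs ! i, xs ! j) \<in> parcs G) \<and>
        (\<forall>r. 1 \<le> r \<and> r < 5 + 2 * d \<and> r \<noteq> 4 \<longrightarrow> M' r = M r)"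
    by (intro exI[of _ M']) (simp add: M'_def)
qed simp

text \<open>The two truncated differences add up to zero exactly for equal values, so inequality is
  the primitive test.\<close>

lemma decidable_neq:
  assumes "i < d" "j < d"
  shows "decidable d (\<lambda>G xs. xs ! i \<noteq> xs ! j)"
proof (rule decidableI[where p="[:3:]" and
      c="\<lambda>_. [Sub 0 (5 + 2 * i) (5 + 2 * j), Sub 4 (5 + 2 * j) (5 + 2 * i), Add 0 0 4]"])
  fix a G xs prog M
  assume A: "G \<in> C" "length xs = d" "set xs \<subseteq> pverts G"
    "code_at prog a [Sub 0 (5 + 2 * i) (5 + 2 * j), Sub 4 (5 + 2 * j) (5 + 2 * i), Add 0 0 4]"
    "represents G xs M"
  have M: "M (5 + 2 * i) = xs ! i" "M (5 + 2 * j) = xs ! j"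
    using A assms by (auto simp: represents_def)
  define M' where "M' = M(4 := xs ! j - xs ! i, 0 := xs ! i - xs ! j + (xs ! j - xs ! i))"
  have "reaches prog (encode_graph G) 3 (a, M) (a + 3, M')"
    using A(4) M unfolding code_at_Cons
    by (simp add: numeral_3_eq_3 reaches_Suc reaches_0 M'_def fun_upd_twist)
  then show "\<exists>M'. reaches prog (encode_graph G) (poly [:3:] (nverts G)) (a, M) (a + 3, M') \<and>
        (M' 0 \<noteq> 0 \<longleftrightarrow> xs ! i \<noteq> xs ! j) \<and> (\<forall>r. 1 \<le> r \<and> r < 5 + 2 * d \<and> r \<noteq> 4 \<longrightarrow> M' r = M r)"
    by (intro exI[of _ M']) (auto simp: M'_def)
qed simp

lemma decidable_not:
  assumes "decidable d P"
  shows "decidable d (\<lambda>G xs. \<not> P G xs)"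
proof -
  obtain c len p where c: "\<And>a. length (c a) = len" "\<And>a. fragment_decides d P a (c a) p"
    using assms unfolding decidable_def by blast
  define e where "e a = [JumpZero 0 (a + len + 3), Const 0 0, Jump (a + len + 4), Const 0 1]" for a
  show ?thesis
  proof (rule decidableI[where c="\<lambda>a. c a @ e a" and p="p + [:3:]" and len="len + 4"])
    fix a G xs prog M
    assume A: "G \<in> C" "length xs = d" "set xs \<subseteq> pverts G"
      "code_at prog a (c a @ e a)" "represents G xs M"
    have co: "code_at prog a (c a)" "code_at prog (a + len) (e a)"
      using A(4) c(1) by (auto simp: code_at_append)
    obtain M1 where M1: "reaches prog (encode_graph G) (poly p (nverts G)) (a, M) (a + len, M1)"
      "M1 0 \<noteq> 0 \<longleftrightarrow> P G xs" "\<And>r. 1 \<le> r \<Longrightarrow> r < 5 + 2 * d \<Longrightarrow> r \<noteq> 4 \<Longrightarrow> M1 r = M r"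
      using fragment_decidesD[OF c(2) A(1-3) co(1) A(5)] c(1) by metis
    define M' where "M' = M1(0 := if P G xs then 0 else 1)"
    have "reaches prog (encode_graph G) 3 (a + len, M1) (a + len + 4, M')"
    proof (cases "P G xs")
      case True
      then show ?thesis using co(2) M1(2) unfolding code_at_Cons e_def
        by (simp add: numeral_3_eq_3 reaches_Suc reaches_0 M'_def)
    next
      case False
      then have "reaches prog (encode_graph G) 2 (a + len, M1) (a + len + 4, M')"
        using co(2) M1(2) unfolding code_at_Cons e_def
        by (simp add: numeral_2_eq_2 numeral_3_eq_3 reaches_Suc reaches_0 M'_def)
      then show ?thesis by (rule reaches_mono) simp
    qed
    then have "reaches prog (encode_graph G) (poly (p + [:3:]) (nverts G)) (a, M) (a + (len + 4), M')"
      using reaches_trans[OF M1(1)] by (simp add: add.assoc)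
    then show "\<exists>M'. reaches prog (encode_graph G) (poly (p + [:3:]) (nverts G)) (a, M) (a + (len + 4), M') \<and>
        (M' 0 \<noteq> 0 \<longleftrightarrow> \<not> P G xs) \<and> (\<forall>r. 1 \<le> r \<and> r < 5 + 2 * d \<and> r \<noteq> 4 \<longrightarrow> M' r = M r)"
      using M1(3) by (intro exI[of _ M']) (simp add: M'_def)
  qed (simp add: c e_def)
qed

text \<open>If the first test fails, register \<open>0\<close> already holds the answer and the
  second test is skipped.\<close>

lemma decidable_conj:
  assumes "decidable d P" "decidable d Q"
  shows "decidable d (\<lambda>G xs. P G xs \<and> Q G xs)"
proof -
  obtain c len p where c: "\<And>a. length (c a) = len" "\<And>a. fragment_decides d P a (c a) p"
    using assms unfolding decidable_def by blast
  obtain c' len' p' where c': "\<And>a. length (c' a) = len'" "\<And>a. fragment_decides d Q a (c' a) p'"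
    using assms unfolding decidable_def by blast
  define e where "e a = c a @ [JumpZero 0 (a + len + 1 + len')] @ c' (a + len + 1)" for a
  let ?p = "p + [:1:] + p'" and ?len = "len + 1 + len'"
  show ?thesis
  proof (rule decidableI[where c=e and p="?p" and len="?len"])
    fix a G xs prog M
    assume A: "G \<in> C" "length xs = d" "set xs \<subseteq> pverts G"
      "code_at prog a (e a)" "represents G xs M"
    have co: "code_at prog a (c a)" "code_at prog (a + len) [JumpZero 0 (a + len + 1 + len')]"
      "code_at prog (a + len + 1) (c' (a + len + 1))"
      using A(4) c(1) by (auto simp: code_at_append e_def code_at_Cons code_at_Nil)
    obtain M1 where M1: "reaches prog (encode_graph G) (poly p (nverts G)) (a, M) (a + len, M1)"
      "M1 0 \<noteq> 0 \<longleftrightarrow> P G xs" "\<And>r. 1 \<le> r \<Longrightarrow> r < 5 + 2 * d \<Longrightarrow> r \<noteq> 4 \<Longrightarrow> M1 r = M r"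
      using fragment_decidesD[OF c(2) A(1-3) co(1) A(5)] c(1) by metis
    show "\<exists>M'. reaches prog (encode_graph G) (poly ?p (nverts G)) (a, M) (a + ?len, M') \<and>
        (M' 0 \<noteq> 0 \<longleftrightarrow> P G xs \<and> Q G xs) \<and> (\<forall>r. 1 \<le> r \<and> r < 5 + 2 * d \<and> r \<noteq> 4 \<longrightarrow> M' r = M r)"
    proof (cases "P G xs")
      case True
      have "represents G xs M1"
        by (rule represents_cong[OF A(5)]) (use M1(3) A(2) in auto)
      then obtain M2 where M2:
        "reaches prog (encode_graph G) (poly p' (nverts G)) (a + len + 1, M1) (a + len + 1 + len', M2)"
        "M2 0 \<noteq> 0 \<longleftrightarrow> Q G xs" "\<And>r. 1 \<le> r \<Longrightarrow> r < 5 + 2 * d \<Longrightarrow> r \<noteq> 4 \<Longrightarrow> M2 r = M1 r"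
        using fragment_decidesD[OF c'(2) A(1-3) co(3)] c'(1) by metis
      have "reaches prog (encode_graph G) 1 (a + len, M1) (a + len + 1, M1)"
        using co(2) M1(2) True by (simp add: code_at_Cons reaches_Suc reaches_0)
      from reaches_trans[OF reaches_trans[OF M1(1) this le_refl] M2(1), of "poly ?p (nverts G)"]
      show ?thesis using M1 M2 True by (intro exI[of _ M2]) (simp add: add.assoc)
    next
      case False
      have "reaches prog (encode_graph G) 1 (a + len, M1) (a + ?len, M1)"
        using co(2) M1(2) False by (simp add: code_at_Cons reaches_Suc reaches_0)
      from reaches_trans[OF M1(1) this, of "poly ?p (nverts G)"]
      show ?thesis using M1 False by (intro exI[of _ M1]) simp
    qed
  qed (simp add: c c' e_def)
qed

text \<open>The loop counter \<open>x\<close> is itself the new variable and \<open>y\<close> its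
  row start; adding \<open>1\<close> and \<open>n\<close> in each round maintains
  \<open>represents\<close> for the body.\<close>

lemma decidable_ex:
  assumes "decidable (Suc d) P"
  shows "decidable d (\<lambda>G xs. \<exists>v\<in>pverts G. P G (xs @ [v]))"
proof -
  obtain c len p where c: "\<And>a. length (c a) = len" "\<And>a. fragment_decides (Suc d) P a (c a) p"
    using assms unfolding decidable_def by blast
  define x y where "x = 5 + 2 * d" and "y = 6 + 2 * d"
  have xy: "x \<noteq> y" "y \<noteq> x" "x > 4" "y > 4" by (auto simp: x_def y_def)
  \<comment> \<open>Offset \<open>2\<close> tests for the end of the range, \<open>4\<close> starts
    the body, \<open>len + 6\<close> the increments, and \<open>len + 9\<close> is the exit. An
    early exit keeps the nonzero result in register \<open>0\<close>; running out of vertices leaves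
    \<open>0\<close> there.\<close>
  define e where "e a = [Const x 0, Add y 3 x, Sub 0 2 x, JumpZero 0 (a + len + 9)] @ c (a + 4) @
    [JumpZero 0 (a + len + 6), Jump (a + len + 9), Add x x 1, Add y y 2, Jump (a + 2)]" for a
  \<comment> \<open>Besides the body, a round takes two steps for the test and at most four
    afterwards; the last four steps are initialisation and final test.\<close>
  let ?p = "[:0, 1:] * (p + [:6:]) + [:4:]" and ?len = "len + 9"
  show ?thesis
  proof (rule decidableI[where c=e and p="?p" and len="?len"])
    fix a G xs prog M
    assume A: "G \<in> C" "length xs = d" "set xs \<subseteq> pverts G"
      "code_at prog a (e a)" "represents G xs M"
    let ?w = "encode_graph G" and ?n = "nverts G"
    have co: "code_at prog a [Const x 0, Add y 3 x, Sub 0 2 x, JumpZero 0 (a + len + 9)]"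
      "code_at prog (a + 4) (c (a + 4))"
      "code_at prog (a + 4 + len)
        [JumpZero 0 (a + len + 6), Jump (a + len + 9), Add x x 1, Add y y 2, Jump (a + 2)]"
      using A(4) c(1)
      by (auto simp: code_at_append e_def code_at_Cons code_at_Nil eval_nat_numeral)
    have loop: "\<exists>M'. reaches prog ?w (m * (poly p ?n + 6) + 2) (a + 2, M1) (a + ?len, M') \<and>
        (M' 0 \<noteq> 0 \<longleftrightarrow> (\<exists>u\<ge>v. u < ?n \<and> P G (xs @ [u]))) \<and>
        (\<forall>r. 1 \<le> r \<and> r < 5 + 2 * d \<and> r \<noteq> 4 \<longrightarrow> M' r = M1 r)"
      if "v + m = ?n" "represents G xs M1" "M1 x = v" "M1 y = ?n + 1 + v * ?n" for m v M1
      using that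
    proof (induction m arbitrary: v M1)
      case 0
      define M2 where "M2 = M1(0 := 0)"
      have "M1 2 = ?n" "M1 x = ?n" using 0 by (auto simp: represents_def)
      then have "reaches prog ?w 2 (a + 2, M1) (a + ?len, M2)"
        using co(1) xy
        by (simp add: eval_nat_numeral code_at_Cons reaches_Suc reaches_0 M2_def)
      moreover have "M2 0 = 0" "\<And>r. r \<ge> 1 \<Longrightarrow> M2 r = M1 r" by (auto simp: M2_def)
      moreover have "\<not> (\<exists>u\<ge>v. u < ?n \<and> P G (xs @ [u]))" using 0(1) by simp
      ultimately show ?case unfolding mult_0 add_0 by blast
    next
      case (Suc m)
      define M2 where "M2 = M1(0 := Suc m)"
      have "M1 2 = v + Suc m" "M1 x = v" using Suc.prems by (auto simp: represents_def)
      then have 1: "reaches prog ?w 2 (a + 2, M1) (a + 4, M2)"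
        using co(1) xy by (simp add: eval_nat_numeral code_at_Cons reaches_Suc reaches_0 M2_def)
      have v: "v < ?n" using Suc.prems by simp
      have "represents G (xs @ [v]) M2"
        using Suc.prems A(2) unfolding represents_def
        by (auto simp: M2_def x_def y_def nth_append less_Suc_eq)
      moreover have "set (xs @ [v]) \<subseteq> pverts G"
        using A(3) v pverts_class[OF A(1)] by auto
      ultimately obtain M3 where M3: "reaches prog ?w (poly p ?n) (a + 4, M2) (a + 4 + len, M3)"
        "M3 0 \<noteq> 0 \<longleftrightarrow> P G (xs @ [v])"
        "\<And>r. 1 \<le> r \<Longrightarrow> r < 5 + 2 * Suc d \<Longrightarrow> r \<noteq> 4 \<Longrightarrow> M3 r = M2 r"
        using fragment_decidesD[OF c(2) A(1) _ _ co(2)] c(1) A(2)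
        by (metis length_append_singleton)
      note 13 = reaches_trans[OF 1 M3(1) le_refl]
      have M31: "M3 r = M1 r" if "1 \<le> r" "r < 5 + 2 * Suc d" "r \<noteq> 4" for r
        using M3(3)[OF that] that by (simp add: M2_def)
      show ?case
      proof (cases "P G (xs @ [v])")
        case True
        have "reaches prog ?w 2 (a + 4 + len, M3) (a + ?len, M3)"
          using co(3) M3(2) True
          by (simp add: numeral_2_eq_2 code_at_Cons reaches_Suc reaches_0)
        from reaches_trans[OF 13 this, of "Suc m * (poly p ?n + 6) + 2"]
        show ?thesis using M3(2) True M31 v by (intro exI[of _ M3]) auto
      next
        case False
        define M4 where "M4 = M3(x := v + 1, y := ?n + 1 + v * ?n + ?n)"
        have "M3 x = v" "M3 y = ?n + 1 + v * ?n" "M3 1 = 1" "M3 2 = ?n"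
          using M31 Suc.prems xy by (auto simp: x_def y_def represents_def)
        then have "reaches prog ?w 4 (a + 4 + len, M3) (a + 2, M4)"
          using co(3) M3(2) False xy
          by (simp add: eval_nat_numeral code_at_Cons reaches_Suc reaches_0 M4_def)
        note 14 = reaches_trans[OF 13 this le_refl]
        have M41: "M4 r = M1 r" if "1 \<le> r" "r < 5 + 2 * d" "r \<noteq> 4" for r
          using M31 that by (simp add: M4_def x_def y_def)
        have "represents G xs M4"
          by (rule represents_cong[OF Suc.prems(2)]) (use M41 A(2) in auto)
        moreover have "M4 x = Suc v" "M4 y = ?n + 1 + Suc v * ?n" using xy by (auto simp: M4_def)
        ultimately obtain M5 where M5:
          "reaches prog ?w (m * (poly p ?n + 6) + 2) (a + 2, M4) (a + ?len, M5)"
          "M5 0 \<noteq> 0 \<longleftrightarrow> (\<exists>u\<ge>Suc v. u < ?n \<and> P G (xs @ [u]))"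
          "\<forall>r. 1 \<le> r \<and> r < 5 + 2 * d \<and> r \<noteq> 4 \<longrightarrow> M5 r = M4 r"
          using Suc.IH[of "Suc v" M4] Suc.prems(1) by auto
        have "(\<exists>u\<ge>Suc v. u < ?n \<and> P G (xs @ [u])) \<longleftrightarrow> (\<exists>u\<ge>v. u < ?n \<and> P G (xs @ [u]))"
          using False by (metis Suc_leD Suc_leI le_neq_implies_less)
        with reaches_trans[OF 14 M5(1), of "Suc m * (poly p ?n + 6) + 2"] M5(2,3) M41
        show ?thesis by (intro exI[of _ M5]) auto
      qed
    qed
    define M1 where "M1 = M(x := 0, y := ?n + 1)"
    have M1: "M1 r = M r" if "1 \<le> r" "r < 5 + 2 * d" "r \<noteq> 4" for r
      using that by (simp add: M1_def x_def y_def)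
    have "M 3 = ?n + 1" using A(5) by (simp add: represents_def)
    then have init: "reaches prog ?w 2 (a, M) (a + 2, M1)"
      using co(1) xy by (simp add: eval_nat_numeral code_at_Cons reaches_Suc reaches_0 M1_def)
    have "represents G xs M1"
      by (rule represents_cong[OF A(5)]) (use M1 A(2) in auto)
    then obtain M' where M':
      "reaches prog ?w (?n * (poly p ?n + 6) + 2) (a + 2, M1) (a + ?len, M')"
      "M' 0 \<noteq> 0 \<longleftrightarrow> (\<exists>u\<ge>0. u < ?n \<and> P G (xs @ [u]))"
      "\<forall>r. 1 \<le> r \<and> r < 5 + 2 * d \<and> r \<noteq> 4 \<longrightarrow> M' r = M1 r"
      using loop[of 0 ?n M1] xy by (auto simp: M1_def)
    from reaches_trans[OF init M'(1), of "poly ?p ?n"]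
    show "\<exists>M'. reaches prog ?w (poly ?p ?n) (a, M) (a + ?len, M') \<and>
        (M' 0 \<noteq> 0 \<longleftrightarrow> (\<exists>v\<in>pverts G. P G (xs @ [v]))) \<and>
        (\<forall>r. 1 \<le> r \<and> r < 5 + 2 * d \<and> r \<noteq> 4 \<longrightarrow> M' r = M r)"
      using M'(2,3) M1 pverts_class[OF A(1)] by (intro exI[of _ M']) auto
  qed (simp add: c e_def)
qed

lemma poly_time_solvable_on_if_decidable:
  assumes "decidable 0 P" and "\<And>G. G \<in> C \<Longrightarrow> P G [] \<longleftrightarrow> Q G"
  shows "poly_time_solvable_on encode_graph C Q"
proof -
  obtain c len p where c: "\<And>a. length (c a) = len" "\<And>a. fragment_decides 0 P a (c a) p"
    using assms unfolding decidable_def by blast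
  \<comment> \<open>Instructions \<open>2\<close> to \<open>6\<close> scan the unary prefix:
    subtracting \<open>1\<close> turns the symbol for \<open>True\<close> into \<open>1\<close> and
    the separator into \<open>0\<close>, so register \<open>2\<close> stops at the number of
    vertices.\<close>
  define pre where "pre = [Const 1 1, Const 2 0, Read 0 2, Sub 0 0 1, JumpZero 0 7, Add 2 2 1, Jump 2,
    Add 3 2 1]"
  define prog where "prog = pre @ c 8"
  have co: "code_at prog 0 pre" "code_at prog 8 (c 8)"
    using code_at_append[of prog 0 pre "c 8"] by (auto simp: prog_def pre_def code_at_def)
  \<comment> \<open>The prologue takes at most \<open>5 * n + 6\<close> steps, where
    \<open>n\<close> is below the input length; \<open>p\<close> is monotone, having natural
    coefficients.\<close>
  let ?p = "[:10, 5:] + p"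
  have "\<exists>t \<le> poly ?p (length (encode_graph G)). halted prog (run prog (encode_graph G) t) \<and>
      (accepting (run prog (encode_graph G) t) \<longleftrightarrow> Q G)" if "G \<in> C" for G
  proof -
    let ?w = "encode_graph G" and ?n = "nverts G"
    have G: "G \<in> C" by (fact that)
    have loop: "\<exists>M'. reaches prog ?w (m * 5 + 3) (2, M) (7, M') \<and> M' 1 = 1 \<and> M' 2 = ?n"
      if "v + m = ?n" "M 1 = 1" "M 2 = v" for m v M
      using that
    proof (induction m arbitrary: v M)
      case 0
      then have "reaches prog ?w 3 (2, M) (7, M(0 := 0))"
        using co(1) input_symbol_unary[of v G]
        by (simp add: pre_def eval_nat_numeral code_at_Cons reaches_Suc reaches_0)
      then show ?case using 0 by (intro exI[of _ "M(0 := 0)"]) (simp del: fun_upd_apply add: fun_upd_other)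
    next
      case (Suc m)
      then have "reaches prog ?w 5 (2, M) (2, M(0 := 1, 2 := Suc v))"
        using co(1) input_symbol_unary[of v G]
        by (simp add: pre_def eval_nat_numeral code_at_Cons reaches_Suc reaches_0)
      moreover obtain M' where
        "reaches prog ?w (m * 5 + 3) (2, M(0 := 1, 2 := Suc v)) (7, M')" "M' 1 = 1" "M' 2 = ?n"
      proof -
        have "Suc v + m = ?n" "(M(0 := 1, 2 := Suc v)) 1 = 1" "(M(0 := 1, 2 := Suc v)) 2 = Suc v"
          using Suc.prems by auto
        from Suc.IH[OF this] that show ?thesis by blast
      qed
      ultimately show ?case
        using reaches_trans[of prog ?w 5 _ _ "m * 5 + 3" _ "Suc m * 5 + 3"] by fastforce
    qed
    let ?M0 = "(\<lambda>_. 0)(1 := 1, 2 := 0) :: nat \<Rightarrow> nat"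
    have 1: "reaches prog ?w 2 (0, \<lambda>_. 0) (2, ?M0)"
      using co(1) by (simp add: pre_def eval_nat_numeral code_at_Cons reaches_Suc reaches_0)
    obtain M1 where M1: "reaches prog ?w (?n * 5 + 3) (2, ?M0) (7, M1)" "M1 1 = 1" "M1 2 = ?n"
      using loop[of 0 ?n ?M0] by auto
    let ?M2 = "M1(3 := ?n + 1)"
    have 2: "reaches prog ?w 1 (7, M1) (8, ?M2)"
      using co(1) M1(2,3)
      by (simp add: pre_def eval_nat_numeral code_at_Cons reaches_Suc reaches_0)
    have "represents G [] ?M2" using M1 by (simp add: represents_def)
    then obtain M' where M': "reaches prog ?w (poly p ?n) (8, ?M2) (8 + len, M')"
      "M' 0 \<noteq> 0 \<longleftrightarrow> P G []"
      using fragment_decidesD[OF c(2) G _ _ co(2), of "[]"] c(1) by (metis empty_set empty_subsetI list.size(3))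
    have "?n \<le> length ?w" by (simp add: length_encode_graph)
    then have "2 + (?n * 5 + 3) + 1 + poly p ?n \<le> poly ?p (length ?w)"
      using poly_nat_mono[of ?n "length ?w" p] by simp
    from reaches_trans[OF reaches_trans[OF reaches_trans[OF 1 M1(1) le_refl] 2 le_refl] M'(1) this]
    obtain t where t: "t \<le> poly ?p (length ?w)" "run prog ?w t = (8 + len, M')"
      unfolding reaches_def run_def by blast
    moreover have "length prog = 8 + len" by (simp add: prog_def pre_def c)
    ultimately show ?thesis using M'(2) assms(2)[OF that] by (auto simp: halted_def accepting_def)
  qed
  then show ?thesis unfolding poly_time_solvable_on_def by blast
qed

end


section \<open>First-order definability\<close>

context graph_class
begin

text \<open>There is no atom without variables, so falsity is expressed by a vertex that differs
  from itself.\<close>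

lemma decidable_False: "decidable d (\<lambda>G xs. False)"
  using decidable_ex[OF decidable_neq[of d "Suc d" d]] by (rule decidable_cong) auto

lemma decidable_const: "decidable d (\<lambda>G xs. b)"
  by (cases b) (use decidable_False decidable_not[OF decidable_False] in auto)

lemma decidable_disj: "decidable d P \<Longrightarrow> decidable d Q \<Longrightarrow> decidable d (\<lambda>G xs. P G xs \<or> Q G xs)"
  using decidable_not[OF decidable_conj[OF decidable_not decidable_not]] by simp

text \<open>The index set is fixed in advance, so the conjunction unrolls into program text and
  \<open>i\<close> is never stored in a register.\<close>

lemma decidable_ball_finite:
  assumes "finite I" "\<And>i. i \<in> I \<Longrightarrow> decidable d (P i)"
  shows "decidable d (\<lambda>G xs. \<forall>i\<in>I. P i G xs)"
  using assms by induction (auto simp: decidable_const intro: decidable_conj)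

lemma decidable_bex_finite:
  assumes "finite I" "\<And>i. i \<in> I \<Longrightarrow> decidable d (P i)"
  shows "decidable d (\<lambda>G xs. \<exists>i\<in>I. P i G xs)"
  using assms by induction (auto simp: decidable_const intro: decidable_disj)

end

section \<open>Terms and quantifiers over tuples\<close>

text \<open>
  Terms with \<open>d\<close> free variables: \<open>var\<close> and \<open>vec\<close> select one component, respectively a list of \<open>m\<close>
  components, of an assignment of length \<open>d\<close>; \<open>ext\<close> forgets all but the first \<open>d\<close> of \<open>d'\<close> components.
\<close>

definition var :: "nat \<Rightarrow> (nat list \<Rightarrow> nat) \<Rightarrow> bool" where
  "var d f \<longleftrightarrow> (\<exists>i<d. \<forall>xs. length xs = d \<longrightarrow> f xs = xs ! i)"

definition vec :: "nat \<Rightarrow> nat \<Rightarrow> (nat list \<Rightarrow> nat list) \<Rightarrow> bool" where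
  "vec d m F \<longleftrightarrow> (\<exists>I. length I = m \<and> set I \<subseteq> {..<d} \<and> (\<forall>xs. length xs = d \<longrightarrow> F xs = map ((!) xs) I))"

definition ext :: "nat \<Rightarrow> nat \<Rightarrow> (nat list \<Rightarrow> nat list) \<Rightarrow> bool" where
  "ext d d' e \<longleftrightarrow> d \<le> d' \<and> (\<forall>xs. length xs = d' \<longrightarrow> e xs = take d xs)"

lemma ext_var:
  assumes "ext d d' e" "var d f"
  shows "var d' (\<lambda>xs. f (e xs))"
proof -
  obtain i where "i < d" "\<And>xs. length xs = d \<Longrightarrow> f xs = xs ! i"
    using assms(2) by (auto simp: var_def)
  then show ?thesis using assms(1) unfolding var_def ext_def by (intro exI[of _ i]) auto
qed

lemma ext_vec: "ext d d' e \<Longrightarrow> vec d m F \<Longrightarrow> vec d' m (\<lambda>xs. F (e xs))"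
  unfolding ext_def vec_def
proof (elim conjE exE)
  fix I assume *: "d \<le> d'" "\<forall>xs. length xs = d' \<longrightarrow> e xs = take d xs" "length I = m" "set I \<subseteq> {..<d}"
    "\<forall>xs. length xs = d \<longrightarrow> F xs = map ((!) xs) I"
  show "\<exists>I. length I = m \<and> set I \<subseteq> {..<d'} \<and> (\<forall>xs. length xs = d' \<longrightarrow> F (e xs) = map ((!) xs) I)"
    by (rule exI[of _ I]) (use * in auto)
qed

lemma ext_comp: "ext d d' e \<Longrightarrow> ext d' d'' e' \<Longrightarrow> ext d d'' (\<lambda>xs. e (e' xs))"
  unfolding ext_def by (auto simp: min_def)

lemma var_nth_vec: "vec d m F \<Longrightarrow> i < m \<Longrightarrow> var d (\<lambda>xs. F xs ! i)"
  unfolding vec_def var_def by (fastforce dest: nth_mem)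

lemma vec_length: "vec d m F \<Longrightarrow> length xs = d \<Longrightarrow> length (F xs) = m"
  by (auto simp: vec_def)

lemma vec_subset: "vec d m F \<Longrightarrow> length xs = d \<Longrightarrow> set (F xs) \<subseteq> set xs"
  by (fastforce simp: vec_def)

lemma vec_append: "vec d m F \<Longrightarrow> vec d m' F' \<Longrightarrow> vec d (m + m') (\<lambda>xs. F xs @ F' xs)"
  unfolding vec_def
proof (elim conjE exE)
  fix I I' assume *: "length I = m" "set I \<subseteq> {..<d}" "\<forall>xs. length xs = d \<longrightarrow> F xs = map ((!) xs) I"
    "length I' = m'" "set I' \<subseteq> {..<d}" "\<forall>xs. length xs = d \<longrightarrow> F' xs = map ((!) xs) I'"
  show "\<exists>I. length I = m + m' \<and> set I \<subseteq> {..<d} \<and>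
      (\<forall>xs. length xs = d \<longrightarrow> F xs @ F' xs = map ((!) xs) I)"
    by (rule exI[of _ "I @ I'"]) (use * in auto)
qed

context graph_class
begin

lemma decidable_var:
  assumes "var d f" "var d g"
  shows "decidable d (\<lambda>G xs. adj G (f xs) (g xs))" "decidable d (\<lambda>G xs. f xs = g xs)"
proof -
  obtain i j where "i < d" "j < d" "\<And>xs. length xs = d \<Longrightarrow> f xs = xs ! i"
    "\<And>xs. length xs = d \<Longrightarrow> g xs = xs ! j" using assms unfolding var_def by blast
  then show "decidable d (\<lambda>G xs. adj G (f xs) (g xs))" "decidable d (\<lambda>G xs. f xs = g xs)"
    using decidable_cong[OF decidable_adj[of i d j]]
      decidable_cong[OF decidable_not[OF decidable_neq[of i d j]]] by auto
qed

lemma decidable_ball_vec: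
  assumes "vec d m F" "\<And>f. var d f \<Longrightarrow> decidable d (\<lambda>G xs. P G xs (f xs))"
  shows "decidable d (\<lambda>G xs. \<forall>x\<in>set (F xs). P G xs x)"
proof (rule decidable_cong)
  show "decidable d (\<lambda>G xs. \<forall>i\<in>{..<m}. P G xs (F xs ! i))"
    by (intro decidable_ball_finite assms(2) var_nth_vec[OF assms(1)]) auto
qed (use vec_length[OF assms(1)] in \<open>auto simp: all_set_conv_all_nth\<close>)

lemma decidable_mem_vec:
  assumes "var d f" "vec d m F"
  shows "decidable d (\<lambda>G xs. f xs \<in> set (F xs))"
proof (rule decidable_cong)
  show "decidable d (\<lambda>G xs. \<not> (\<forall>x\<in>set (F xs). \<not> x = f xs))"
    by (intro decidable_not decidable_ball_vec[OF assms(2)] decidable_var(2) assms(1))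
qed auto

lemma decidable_successively_vec:
  assumes "vec d m F" "\<And>f g. var d f \<Longrightarrow> var d g \<Longrightarrow> decidable d (\<lambda>G xs. P G xs (f xs) (g xs))"
  shows "decidable d (\<lambda>G xs. successively (P G xs) (F xs))"
proof (rule decidable_cong)
  show "decidable d (\<lambda>G xs. \<forall>i\<in>{i. Suc i < m}. P G xs (F xs ! i) (F xs ! Suc i))"
    by (intro decidable_ball_finite assms(2) var_nth_vec[OF assms(1)])
      (auto intro: finite_subset[of _ "{..<m}"])
qed (use vec_length[OF assms(1)] in \<open>auto simp: successively_conv_nth\<close>)

lemma decidable_distinct_vec:
  assumes "vec d m F"
  shows "decidable d (\<lambda>G xs. distinct (F xs))"
proof (rule decidable_cong)
  show "decidable d (\<lambda>G xs. \<forall>i\<in>{..<m}. \<forall>j\<in>{..<m} - {i}. \<not> F xs ! i = F xs ! j)"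
    by (intro decidable_ball_finite decidable_not decidable_var(2) var_nth_vec[OF assms]) auto
qed (use vec_length[OF assms] in \<open>auto simp: distinct_conv_nth\<close>)

text \<open>Since \<open>hd []\<close> and \<open>last []\<close> are unspecified, the conjunct on
  nonemptiness settles the case \<open>m = 0\<close>.\<close>

lemma decidable_ends_vec:
  assumes "vec d m F" "var d f"
  shows "decidable d (\<lambda>G xs. F xs \<noteq> [] \<and> hd (F xs) = f xs)"
    "decidable d (\<lambda>G xs. F xs \<noteq> [] \<and> last (F xs) = f xs)"
proof -
  have len: "length (F xs) = m" if "length xs = d" for xs using vec_length[OF assms(1) that] .
  have "decidable d (\<lambda>G xs. F xs \<noteq> [] \<and> hd (F xs) = f xs) \<and>
    decidable d (\<lambda>G xs. F xs \<noteq> [] \<and> last (F xs) = f xs)"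
  proof (cases "m = 0")
    case True
    then show ?thesis using len by (auto intro!: decidable_cong[OF decidable_False])
  next
    case False
    then have F: "F xs \<noteq> [] \<and> hd (F xs) = F xs ! 0 \<and> last (F xs) = F xs ! (m - 1)"
      if "length xs = d" for xs
      using len[OF that] by (metis hd_conv_nth last_conv_nth list.size(3))
    have "decidable d (\<lambda>G xs. F xs ! 0 = f xs)" "decidable d (\<lambda>G xs. F xs ! (m - 1) = f xs)"
      using False by (auto intro!: decidable_var(2) var_nth_vec[OF assms(1)] assms(2))
    from this[THEN decidable_cong] show ?thesis using F by simp
  qed
  then show "decidable d (\<lambda>G xs. F xs \<noteq> [] \<and> hd (F xs) = f xs)"
    "decidable d (\<lambda>G xs. F xs \<noteq> [] \<and> last (F xs) = f xs)" by blast+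
qed

lemma decidable_ex_append:
  assumes "decidable (d + m) P"
  shows "decidable d (\<lambda>G xs. \<exists>ys. length ys = m \<and> set ys \<subseteq> pverts G \<and> P G (xs @ ys))"
  using assms
proof (induction m arbitrary: d)
  case (Suc m)
  then have "decidable (Suc d) (\<lambda>G xs. \<exists>ys. length ys = m \<and> set ys \<subseteq> pverts G \<and> P G (xs @ ys))"
    by simp
  from decidable_ex[OF this] show ?case
  proof (rule decidable_cong)
    fix G xs
    show "(\<exists>v\<in>pverts G. \<exists>ys. length ys = m \<and> set ys \<subseteq> pverts G \<and> P G ((xs @ [v]) @ ys)) \<longleftrightarrow>
      (\<exists>ys. length ys = Suc m \<and> set ys \<subseteq> pverts G \<and> P G (xs @ ys))" (is "?L \<longleftrightarrow> ?R")
    proof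
      assume ?L
      then obtain v ys where "v \<in> pverts G" "length ys = m" "set ys \<subseteq> pverts G" "P G (xs @ v # ys)"
        by auto
      then show ?R by (intro exI[of _ "v # ys"]) auto
    next
      assume ?R
      then obtain ys where "length ys = Suc m" "set ys \<subseteq> pverts G" "P G (xs @ ys)" by blast
      then show ?L by (cases ys) auto
    qed
  qed
qed (auto elim: decidable_cong)

text \<open>The body is treated over an arbitrary larger assignment, from which \<open>e\<close>
  recovers the old one and \<open>F\<close> the new list. This replaces index shifting, so nested
  quantifiers can be handled by introduction rules.\<close>

lemma decidable_ex_list:
  assumes "\<And>d' e F. ext d d' e \<Longrightarrow> vec d' m F \<Longrightarrow> decidable d' (\<lambda>G xs. P G (e xs) (F xs))"
  shows "decidable d (\<lambda>G xs. \<exists>ys. length ys = m \<and> set ys \<subseteq> pverts G \<and> P G xs ys)"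
proof -
  have "ext d (d + m) (take d)" by (simp add: ext_def)
  moreover have "vec (d + m) m (drop d)"
    unfolding vec_def by (rule exI[of _ "[d..<d + m]"]) (auto intro: nth_equalityI)
  ultimately show ?thesis
    by (rule decidable_cong[OF decidable_ex_append[OF assms]]) auto
qed

text \<open>\<open>vec\<close> has a fixed length, hence one block of quantifiers for each length up
  to \<open>B\<close>.\<close>

lemma decidable_ex_list_le:
  assumes "\<And>m d' e F. ext d d' e \<Longrightarrow> vec d' m F \<Longrightarrow> decidable d' (\<lambda>G xs. P G (e xs) (F xs))"
  shows "decidable d (\<lambda>G xs. \<exists>ys. length ys \<le> B \<and> set ys \<subseteq> pverts G \<and> P G xs ys)"
proof (rule decidable_cong)
  show "decidable d (\<lambda>G xs. \<exists>m\<in>{..B}. \<exists>ys. length ys = m \<and> set ys \<subseteq> pverts G \<and> P G xs ys)"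
    by (intro decidable_bex_finite decidable_ex_list assms) auto
qed auto

lemma decidable_bex:
  assumes "\<And>d' e f. ext d d' e \<Longrightarrow> var d' f \<Longrightarrow> decidable d' (\<lambda>G xs. P G (e xs) (f xs))"
  shows "decidable d (\<lambda>G xs. \<exists>v\<in>pverts G. P G xs v)"
proof (rule decidable_cong)
  show "decidable d (\<lambda>G xs. \<exists>ys. length ys = 1 \<and> set ys \<subseteq> pverts G \<and> P G xs (ys ! 0))"
    by (intro decidable_ex_list assms var_nth_vec) auto
  fix G xs
  show "(\<exists>ys. length ys = 1 \<and> set ys \<subseteq> pverts G \<and> P G xs (ys ! 0)) \<longleftrightarrow> (\<exists>v\<in>pverts G. P G xs v)"
  proof
    assume "\<exists>v\<in>pverts G. P G xs v"
    then obtain v where "v \<in> pverts G" "P G xs v" by blast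
    then show "\<exists>ys. length ys = 1 \<and> set ys \<subseteq> pverts G \<and> P G xs (ys ! 0)"
      by (intro exI[of _ "[v]"]) simp
  qed (auto simp: length_Suc_conv)
qed

text \<open>Paths differ in length, so they are quantified one by one, each with its own
  \<open>m\<close>; \<open>ext_vec\<close> carries the earlier ones along.\<close>

lemma decidable_ex_lists:
  assumes "\<And>d' e FF. ext d d' e \<Longrightarrow> (\<And>i. i < l \<Longrightarrow> \<exists>m. vec d' m (\<lambda>xs. FF xs ! i)) \<Longrightarrow>
      decidable d' (\<lambda>G xs. P G (e xs) (FF xs))"
  shows "decidable d (\<lambda>G xs. \<exists>ps. length ps = l \<and> (\<forall>p\<in>set ps. length p \<le> B \<and> set p \<subseteq> pverts G) \<and>
      P G xs ps)"
  using assms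
proof (induction l arbitrary: d P)
  case 0
  have "decidable d (\<lambda>G xs. P G xs [])" using 0[of d "\<lambda>xs. xs" "\<lambda>_. []"] by (simp add: ext_def)
  then show ?case by (rule decidable_cong) auto
next
  case (Suc l)
  have "decidable d (\<lambda>G xs. \<exists>p. length p \<le> B \<and> set p \<subseteq> pverts G \<and>
      (\<exists>ps. length ps = l \<and> (\<forall>p\<in>set ps. length p \<le> B \<and> set p \<subseteq> pverts G) \<and> P G xs (p # ps)))"
  proof (rule decidable_ex_list_le)
    fix m d' e F assume 1: "ext d d' e" "vec d' m F"
    show "decidable d' (\<lambda>G xs. \<exists>ps. length ps = l \<and>
        (\<forall>p\<in>set ps. length p \<le> B \<and> set p \<subseteq> pverts G) \<and> P G (e xs) (F xs # ps))"
    proof (rule Suc.IH[where P="\<lambda>G xs ps. P G (e xs) (F xs # ps)"])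
      fix d'' e' FF
      assume 2: "ext d' d'' e'" "\<And>i. i < l \<Longrightarrow> \<exists>m. vec d'' m (\<lambda>xs. FF xs ! i)"
      show "decidable d'' (\<lambda>G xs. P G (e (e' xs)) (F (e' xs) # FF xs))"
      proof (rule Suc.prems[OF ext_comp[OF 1(1) 2(1)]])
        fix i assume "i < Suc l"
        then show "\<exists>m. vec d'' m (\<lambda>xs. (F (e' xs) # FF xs) ! i)"
          using ext_vec[OF 2(1) 1(2)] 2(2) by (cases i) auto
      qed
    qed
  qed
  then show ?case
  proof (rule decidable_cong)
    fix G xs
    show "(\<exists>p. length p \<le> B \<and> set p \<subseteq> pverts G \<and>
        (\<exists>ps. length ps = l \<and> (\<forall>p\<in>set ps. length p \<le> B \<and> set p \<subseteq> pverts G) \<and> P G xs (p # ps))) \<longleftrightarrow>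
      (\<exists>ps. length ps = Suc l \<and> (\<forall>p\<in>set ps. length p \<le> B \<and> set p \<subseteq> pverts G) \<and> P G xs ps)"
      (is "?L \<longleftrightarrow> ?R")
    proof
      assume ?L
      then obtain p ps where "length p \<le> B" "set p \<subseteq> pverts G" "length ps = l"
        "\<forall>p\<in>set ps. length p \<le> B \<and> set p \<subseteq> pverts G" "P G xs (p # ps)" by blast
      then show ?R by (intro exI[of _ "p # ps"]) simp
    next
      assume ?R
      then obtain ps where *: "length ps = Suc l" "\<forall>p\<in>set ps. length p \<le> B \<and> set p \<subseteq> pverts G"
        "P G xs ps" by blast
      then obtain p ps' where "ps = p # ps'" by (cases ps) auto
      with * show ?L by (intro exI[of _ p]) auto
    qed
  qed
qed

lemma decidable_linkage:
  assumes "\<And>i. i < l \<Longrightarrow> \<exists>m. vec d m (\<lambda>xs. FF xs ! i)" "vec d l S" "vec d l T"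
  shows "decidable d (\<lambda>G xs. linkage (adj G) (pverts G) l (S xs) (T xs) ((!) (FF xs)))"
proof (rule decidable_cong)
  obtain m where m: "\<And>i. i < l \<Longrightarrow> vec d (m i) (\<lambda>xs. FF xs ! i)" using assms(1) by metis
  show "decidable d (\<lambda>G xs. (\<forall>i\<in>{..<l}. distinct (FF xs ! i) \<and> successively (adj G) (FF xs ! i) \<and>
      (FF xs ! i \<noteq> [] \<and> hd (FF xs ! i) = S xs ! i) \<and> (FF xs ! i \<noteq> [] \<and> last (FF xs ! i) = T xs ! i)) \<and>
      (\<forall>i\<in>{..<l}. \<forall>j\<in>{..<l} - {i}. \<forall>x\<in>set (FF xs ! i). \<not> x \<in> set (FF xs ! j)))"
    by (intro decidable_conj decidable_ball_finite decidable_distinct_vec decidable_successively_vec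
        decidable_var decidable_ends_vec decidable_not)
      (auto intro!: m var_nth_vec[OF assms(2)] var_nth_vec[OF assms(3)] decidable_ball_vec[OF m]
        decidable_not decidable_mem_vec)
  fix G :: "nat pair_pre_digraph" and xs :: "nat list"
  assume xs: "length xs = d" "set xs \<subseteq> pverts G"
  \<comment> \<open>Variables range over vertices, which supplies this clause of
    \<open>linkage\<close>.\<close>
  have "set (FF xs ! i) \<subseteq> pverts G" if "i < l" for i
    using vec_subset[OF m[OF that] xs(1)] xs(2) by blast
  then show "((\<forall>i\<in>{..<l}. distinct (FF xs ! i) \<and> successively (adj G) (FF xs ! i) \<and>
      (FF xs ! i \<noteq> [] \<and> hd (FF xs ! i) = S xs ! i) \<and> (FF xs ! i \<noteq> [] \<and> last (FF xs ! i) = T xs ! i)) \<and>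
      (\<forall>i\<in>{..<l}. \<forall>j\<in>{..<l} - {i}. \<forall>x\<in>set (FF xs ! i). \<not> x \<in> set (FF xs ! j))) \<longleftrightarrow>
      linkage (adj G) (pverts G) l (S xs) (T xs) ((!) (FF xs))"
    unfolding linkage_def by blast
qed

end

section \<open>Deciding the certificate\<close>

locale bounded_graph_class = graph_class C for C +
  fixes k :: nat
  assumes bounded: "G \<in> C \<Longrightarrow> bounded_independence G k"
begin

lemma decidable_joined:
  assumes "vec d m X" "var d f" "var d g"
  shows "decidable d (\<lambda>G xs. joined G (set (X xs)) (f xs) (g xs))"
proof (rule decidable_cong)
  show "decidable d (\<lambda>G xs. \<exists>p. length p \<le> 2 * k \<and> set p \<subseteq> pverts G \<and>
      (\<forall>x\<in>set p. \<not> x \<in> set (X xs)) \<and> successively (adj G) p \<and>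
      (p \<noteq> [] \<and> hd p = f xs) \<and> (p \<noteq> [] \<and> last p = g xs))"
  proof (rule decidable_ex_list_le)
    fix n d' e p assume e: "ext d d' e" and p: "vec d' n p"
    note [intro] = ext_vec[OF e assms(1)] ext_var[OF e assms(2)] ext_var[OF e assms(3)]
    show "decidable d' (\<lambda>G xs. (\<forall>x\<in>set (p xs). \<not> x \<in> set (X (e xs))) \<and> successively (adj G) (p xs) \<and>
        (p xs \<noteq> [] \<and> hd (p xs) = f (e xs)) \<and> (p xs \<noteq> [] \<and> last (p xs) = g (e xs)))"
      by (intro decidable_conj decidable_ends_vec[OF p] decidable_successively_vec[OF p] decidable_var
          decidable_ball_vec[OF p] decidable_not decidable_mem_vec) auto
  qed
qed (use bounded_independence.joined_iff_short[OF bounded] in blast)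

lemma decidable_robust:
  assumes X: "vec d m X"
  shows "decidable d (\<lambda>G xs. robust G (set (X xs)) c)"
proof (rule decidable_cong)
  \<comment> \<open>The union is written as \<open>set (X xs @ S)\<close> because \<open>vec\<close>
    is closed under append.\<close>
  show "decidable d (\<lambda>G xs. \<not> (\<exists>S. length S \<le> c \<and> set S \<subseteq> pverts G \<and> (\<exists>u\<in>pverts G. \<exists>v\<in>pverts G.
    \<not> u \<in> set S \<and> \<not> v \<in> set S \<and> joined G (set (X xs)) u v \<and> \<not> joined G (set (X xs @ S)) u v)))"
  proof (intro decidable_not decidable_ex_list_le decidable_bex)
    fix n d1 e1 S d2 e2 u d3 e3 v
    assume *: "ext d d1 e1" "vec d1 n S" "ext d1 d2 e2" "var d2 u" "ext d2 d3 e3" "var d3 v"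
    note 1 = ext_vec[OF *(5) ext_vec[OF *(3) *(2)]]
      ext_vec[OF *(5) ext_vec[OF *(3) ext_vec[OF *(1) X]]]
      ext_var[OF *(5) *(4)] *(6)
    show "decidable d3 (\<lambda>G xs. \<not> u (e3 xs) \<in> set (S (e2 (e3 xs))) \<and> \<not> v xs \<in> set (S (e2 (e3 xs))) \<and>
      joined G (set (X (e1 (e2 (e3 xs))))) (u (e3 xs)) (v xs) \<and>
      \<not> joined G (set (X (e1 (e2 (e3 xs))) @ S (e2 (e3 xs)))) (u (e3 xs)) (v xs))"
      by (intro decidable_conj decidable_not decidable_mem_vec[OF _ 1(1)] decidable_joined[OF 1(2)]
          decidable_joined[OF vec_append[OF 1(2,1)]] 1(3,4))
  qed
  fix G xs assume "G \<in> C" "length xs = d" "set xs \<subseteq> pverts G"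
  then have "set (X xs) \<subseteq> pverts G" using vec_subset[OF X] by blast
  from bounded_independence.robust_iff_lists[OF bounded[OF \<open>G \<in> C\<close>] this]
  show "(\<not> (\<exists>S. length S \<le> c \<and> set S \<subseteq> pverts G \<and> (\<exists>u\<in>pverts G. \<exists>v\<in>pverts G.
    \<not> u \<in> set S \<and> \<not> v \<in> set S \<and> joined G (set (X xs)) u v \<and> \<not> joined G (set (X xs @ S)) u v))) \<longleftrightarrow>
    robust G (set (X xs)) c" by simp
qed

lemma decidable_enters:
  assumes "vec d m X" "var d w" "vec d n p"
  shows "decidable d (\<lambda>G xs. enters G (set (X xs)) (w xs) (p xs))"
  unfolding enters_def
  by (intro decidable_not decidable_successively_vec[OF assms(3)] decidable_conj
      decidable_joined[OF assms(1,2)])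

lemma decidable_seed:
  assumes X: "vec d m X" and FF: "\<And>i. i < l \<Longrightarrow> \<exists>m. vec d m (\<lambda>xs. FF xs ! i)"
  shows "decidable d (\<lambda>G xs. seed G (set (X xs)) l ((!) (FF xs)))"
proof (rule decidable_cong)
  obtain n where n: "\<And>i. i < l \<Longrightarrow> vec d (n i) (\<lambda>xs. FF xs ! i)" using FF by metis
  \<comment> \<open>The loop for \<open>w\<close> runs over all of \<open>pverts G\<close>, so
    vertices of \<open>X\<close> are exempted by a disjunct.\<close>
  show "decidable d (\<lambda>G xs. (\<forall>x\<in>set (X xs). \<exists>i\<in>{..<l}. x \<in> set (FF xs ! i)) \<and>
    \<not> (\<exists>w\<in>pverts G. \<not> (w \<in> set (X xs) \<or> (\<exists>i\<in>{..<l}. w \<in> set (FF xs ! i)) \<or>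
      (\<exists>i\<in>{..<l}. enters G (set (X xs)) w (FF xs ! i)))))"
  proof (intro decidable_conj decidable_not decidable_ball_vec[OF X] decidable_bex)
    fix f assume "var d f"
    then show "decidable d (\<lambda>G xs. \<exists>i\<in>{..<l}. f xs \<in> set (FF xs ! i))"
      by (intro decidable_bex_finite decidable_mem_vec[OF _ n]) auto
  next
    fix d' e w assume e: "ext d d' e" "var d' w"
    show "decidable d' (\<lambda>G xs. w xs \<in> set (X (e xs)) \<or> (\<exists>i\<in>{..<l}. w xs \<in> set (FF (e xs) ! i)) \<or>
        (\<exists>i\<in>{..<l}. enters G (set (X (e xs))) (w xs) (FF (e xs) ! i)))"
      by (intro decidable_disj decidable_bex_finite decidable_mem_vec[OF e(2) ext_vec[OF e(1) X]]
          decidable_mem_vec[OF e(2) ext_vec[OF e(1) n]]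
          decidable_enters[OF ext_vec[OF e(1) X] e(2) ext_vec[OF e(1) n]]) auto
  qed
qed (auto simp: seed_def covered_def)

lemma decidable_certified:
  assumes S: "vec d l S" and T: "vec d l T"
  shows "decidable d (\<lambda>G xs. certified k l G (S xs) (T xs))"
proof (rule decidable_cong)
  show "decidable d (\<lambda>G xs. \<exists>j\<in>{..<k}. \<exists>X. length X \<le> deletion_bound k l j \<and> set X \<subseteq> pverts G \<and>
     (robust G (set X) (robustness k l (deletion_bound k l j)) \<and>
     (\<exists>ps. length ps = l \<and>
        (\<forall>p\<in>set ps. length p \<le> seed_bound k l (deletion_bound k l j) \<and> set p \<subseteq> pverts G) \<and>
        (linkage (adj G) (pverts G) l (S xs) (T xs) ((!) ps) \<and> seed G (set X) l ((!) ps)))))"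
  proof (intro decidable_bex_finite decidable_ex_list_le decidable_conj)
    fix j m d' e X assume 1: "ext d d' e" "vec d' m X"
    show "decidable d' (\<lambda>G xs. robust G (set (X xs)) (robustness k l (deletion_bound k l j)))"
      by (rule decidable_robust[OF 1(2)])
    show "decidable d' (\<lambda>G xs. \<exists>ps. length ps = l \<and>
        (\<forall>p\<in>set ps. length p \<le> seed_bound k l (deletion_bound k l j) \<and> set p \<subseteq> pverts G) \<and>
        (linkage (adj G) (pverts G) l (S (e xs)) (T (e xs)) ((!) ps) \<and> seed G (set (X xs)) l ((!) ps)))"
    proof (rule decidable_ex_lists)
      fix d'' e' FF
      assume 2: "ext d' d'' e'" "\<And>i. i < l \<Longrightarrow> \<exists>m. vec d'' m (\<lambda>xs. FF xs ! i)"
      show "decidable d'' (\<lambda>G xs. linkage (adj G) (pverts G) l (S (e (e' xs))) (T (e (e' xs))) ((!) (FF xs)) \<and>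
          seed G (set (X (e' xs))) l ((!) (FF xs)))"
        by (intro decidable_conj decidable_linkage[OF 2(2)] decidable_seed[OF _ 2(2)])
          (auto intro: ext_vec[OF 2(1) ext_vec[OF 1(1) S]] ext_vec[OF 2(1) ext_vec[OF 1(1) T]]
            ext_vec[OF 2(1) 1(2)])
    qed
  qed simp
qed (auto simp: certified_def Bex_def)

lemma spanning_iff: "G \<in> C \<Longrightarrow> (\<exists>P. spanning_linkage l G s t P) \<longleftrightarrow> certified k l G s t"
  by (rule bounded_independence.spanning_linkage_iff_certified[OF bounded])

lemma decidable_ex_terminal_pairs:
  assumes "\<And>d s t. vec d l s \<Longrightarrow> vec d l t \<Longrightarrow> decidable d (\<lambda>G xs. P G (s xs) (t xs))"
  shows "decidable d (\<lambda>G xs. \<exists>s t. terminal_pairs l G s t \<and> P G s t)"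
proof (rule decidable_cong)
  show "decidable d (\<lambda>G xs. \<exists>s. length s = l \<and> set s \<subseteq> pverts G \<and>
      (\<exists>t. length t = l \<and> set t \<subseteq> pverts G \<and> (distinct (s @ t) \<and> P G s t)))"
  proof (intro decidable_ex_list decidable_conj)
    fix d1 e1 s d2 e2 t
    assume "vec d1 l s" "ext d1 d2 e2" and t: "vec d2 l t"
    note s = ext_vec[OF this(2,1)]
    show "decidable d2 (\<lambda>G xs. distinct (s (e2 xs) @ t xs))"
      and "decidable d2 (\<lambda>G xs. P G (s (e2 xs)) (t xs))"
      by (rule decidable_distinct_vec[OF vec_append[OF s t]], rule assms[OF s t])
  qed
qed (auto simp: terminal_pairs_def)

lemma poly_time_has_path_cover: "poly_time_solvable_on encode_graph C (has_path_cover l)"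
proof (rule poly_time_solvable_on_if_decidable)
  show "decidable 0 (\<lambda>G xs. \<exists>s t. terminal_pairs l G s t \<and> certified k l G s t)"
    by (intro decidable_ex_terminal_pairs decidable_certified)
qed (simp add: has_path_cover_def spanning_iff)

lemma poly_time_hamiltonian_linked: "poly_time_solvable_on encode_graph C (hamiltonian_linked l)"
proof (rule poly_time_solvable_on_if_decidable)
  \<comment> \<open>The lower bound on the order becomes the existence of \<open>2 * l\<close>
    distinct vertices, and the universal statement on terminals a failed search for a
    counterexample.\<close>
  show "decidable 0 (\<lambda>G xs. (\<exists>zs. length zs = 2 * l \<and> set zs \<subseteq> pverts G \<and> distinct zs) \<and>
      \<not> (\<exists>s t. terminal_pairs l G s t \<and> \<not> certified k l G s t))"
    by (intro decidable_conj decidable_not decidable_ex_list decidable_distinct_vec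
        decidable_ex_terminal_pairs decidable_certified)
  fix G assume G: "G \<in> C"
  have fin: "finite (pverts G)" using pverts_class[OF G] by simp
  have "2 * l \<le> card (pverts G) \<longleftrightarrow> (\<exists>zs. length zs = 2 * l \<and> set zs \<subseteq> pverts G \<and> distinct zs)"
  proof
    assume "2 * l \<le> card (pverts G)"
    then obtain A where "A \<subseteq> pverts G" "card A = 2 * l" by (metis obtain_subset_with_card_n)
    moreover from this obtain zs where "set zs = A" "distinct zs"
      using fin finite_distinct_list finite_subset by metis
    ultimately show "\<exists>zs. length zs = 2 * l \<and> set zs \<subseteq> pverts G \<and> distinct zs"
      using distinct_card by metis
  next
    assume "\<exists>zs. length zs = 2 * l \<and> set zs \<subseteq> pverts G \<and> distinct zs"
    then obtain zs where "length zs = 2 * l" "set zs \<subseteq> pverts G" "distinct zs" by blast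
    then show "2 * l \<le> card (pverts G)" using card_mono[OF fin, of "set zs"] distinct_card[of zs] by simp
  qed
  then show "((\<exists>zs. length zs = 2 * l \<and> set zs \<subseteq> pverts G \<and> distinct zs) \<and>
      \<not> (\<exists>s t. terminal_pairs l G s t \<and> \<not> certified k l G s t)) \<longleftrightarrow> hamiltonian_linked l G"
    unfolding hamiltonian_linked_def spanning_iff[OF G] by blast
qed

end

theorem theorem7:
  fixes k l :: nat
  assumes "k > 0" and "l > 0"
  shows "poly_time_solvable_on encode_graph
           {G \<in> input_graphs. independence_number G < k} (hamiltonian_linked l) \<and>
         poly_time_solvable_on encode_graph
           {G \<in> input_graphs. independence_number G < k} (has_path_cover l)"
proof -
  interpret bounded_graph_class "{G \<in> input_graphs. independence_number G < k}" k
  proof (intro bounded_graph_class.intro graph_class.intro bounded_graph_class_axioms.intro)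
    fix G assume "G \<in> {G \<in> input_graphs. independence_number G < k}"
    then show "bounded_independence G k"
      by (intro bounded_independence_if_independence_number_less) (simp_all add: input_graphs_def)
  qed blast
  show ?thesis using poly_time_hamiltonian_linked poly_time_has_path_cover by blast
qed

end
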